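(* Let $q\ge 2$ be an integer and let $f:\mathbb{N}\to\mathbb{C}$ be a multiplicative $q$-automatic sequence. Then there exist a Dirichlet character $\chi$ and an integer $Q\ge 1$ such that either $f(n)=\chi(n)$ for all $n$ with $\gcd(n,Q)=1$, or $f(p)=0$ for all sufficiently large primes $p$.
   Context: A function $f:\mathbb{N}\to\mathbb{C}$ is multiplicative if $f(mn)=f(m)f(n)$ whenever $\gcd(m,n)=1$. For an integer $q\ge 2$, $f$ is called $q$-automatic if its $q$-kernel $K_q(f)=\{\{f(q^in+r)\}_{n\ge 0} : i\ge 1,\ 0\le r\le q^i-1\}$ is a finite set of sequences. *)

theory Defs
  imports Complex_Main "HOL-Computational_Algebra.Primes"
begin

text \<open>Multiplicative arithmetic function: f(mn) = f(m) f(n) for coprime positive m, n.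
  The value at 0 is unconstrained (the kernel uses indices n \<ge> 0).\<close>
definition multiplicative :: "(nat \<Rightarrow> complex) \<Rightarrow> bool" where
  "multiplicative f \<longleftrightarrow>
     (\<forall>m n. m > 0 \<longrightarrow> n > 0 \<longrightarrow> coprime m n \<longrightarrow> f (m * n) = f m * f n)"

definition q_kernel :: "nat \<Rightarrow> (nat \<Rightarrow> 'a) \<Rightarrow> (nat \<Rightarrow> 'a) set" where
  "q_kernel q f = {(\<lambda>n. f (q ^ i * n + r)) | i r. i \<ge> 1 \<and> r \<le> q ^ i - 1}"

definition q_automatic :: "nat \<Rightarrow> (nat \<Rightarrow> 'a) \<Rightarrow> bool" where
  "q_automatic q f \<longleftrightarrow> finite (q_kernel q f)"

definition dirichlet_character :: "nat \<Rightarrow> (nat \<Rightarrow> complex) \<Rightarrow> bool" where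
  "dirichlet_character m \<chi> \<longleftrightarrow> m \<ge> 1 \<and>
     (\<forall>a b. \<chi> (a * b) = \<chi> a * \<chi> b) \<and>
     (\<forall>n. \<chi> (n + m) = \<chi> n) \<and>
     \<chi> 1 = 1 \<and>
     (\<forall>n. \<chi> n = 0 \<longleftrightarrow> \<not> coprime n m)"

end

theory Submission
  imports Defs "HOL-Number_Theory.Number_Theory" "HOL-Library.Ramsey"
begin

text \<open>
  Give every natural number the colour by which its base-\<open>q\<close> digits, followed by zeros, act on the
  kernel of \<open>f\<close>. There are finitely many colours, a block of digits may be replaced by another
  block of the same colour, and the length of a long enough gap of zeros does not matter
  (after \<open>q\<close> has been replaced by a power).

  Suppose that \<open>f p \<noteq> 0\<close> for infinitely many primes. A product of factors \<open>1 + a q\<^sup>j\<close> on which \<open>f\<close>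
  does not vanish has many free blocks, and replacing them reaches every residue class modulo a power
  of a large prime \<open>p\<close>; hence \<open>f (p ^ e) \<noteq> 0\<close> for all large \<open>p\<close>. Comparing \<open>f (p (1 + m q\<^sup>j))\<close> for
  different \<open>j\<close> shows that \<open>f\<close> is completely multiplicative on the integers coprime to some \<open>Q\<close>.

  If \<open>s\<close> and \<open>t\<close> have the same colour, so have \<open>s (1 + t q\<^sup>j)\<close> and \<open>t (1 + s q\<^sup>j)\<close>. Hence, in the finite
  group of classes generated by the colours, the class of \<open>1 + k s\<close> depends only on that of \<open>s\<close>, and
  for suitable \<open>k\<close> the induced map is an idempotent homomorphism \<open>\<Lambda>\<close>. If \<open>y\<close> is a multiple of a
  representative of every colour, \<open>\<Lambda>\<close> is constant on the intervals \<open>q\<^sup>j k y + r\<close> with \<open>r < q\<^sup>j / q\<close>.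
  By homogeneity it is eventually periodic, and so trivial on \<open>n \<equiv> 1\<close> modulo \<open>Q\<close>: there
  \<open>1 + k n\<close> lies in the trivial class, which makes the classes, and with them \<open>f\<close>, periodic.
\<close>

section \<open>Digit colourings of automatic sequences\<close>

text \<open>The strict bounds \<open>i < j\<close> leave at least one zero digit above the low
  block, and with that zero its colour decides; \<open>high\<close> allows the blocks to touch. By
  \<open>gap\<close> the length of a positive gap of zeros does not matter.\<close>

locale digit_colouring =
  fixes q :: nat and kap :: "nat \<Rightarrow> 'c" and f :: "nat \<Rightarrow> complex"
  assumes q2: "q \<ge> 2"
    and finite_colours: "finite (range kap)"
    and low: "\<lbrakk>kap r = kap r'; r < q ^ i; r' < q ^ i; i < j\<rbrakk> \<Longrightarrow> kap (r + q ^ j * m) = kap (r' + q ^ j * m)"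
    and high: "\<lbrakk>kap m = kap m'; r < q ^ i\<rbrakk> \<Longrightarrow> kap (r + q ^ i * m) = kap (r + q ^ i * m')"
    and gap: "\<lbrakk>r < q ^ i; i < j; i < k\<rbrakk> \<Longrightarrow> kap (r + q ^ j * m) = kap (r + q ^ k * m)"
    and colour_determines: "kap m = kap n \<Longrightarrow> f m = f n"

text \<open>Two iterates agree on the finite set, so the iterates are eventually periodic; a
  multiple of the period beyond the preperiod is idempotent.\<close>

lemma idempotent_iterate:
  assumes "finite A" and "s ` A \<subseteq> A"
  obtains z where "z \<ge> 1" and "\<And>x. x \<in> A \<Longrightarrow> (s ^^ (2 * z)) x = (s ^^ z) x"
proof -
  have maps: "(s ^^ n) x \<in> A" if "x \<in> A" for n x
    using that assms(2) by (induction n) auto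
  have "\<not> inj (\<lambda>n::nat. restrict (s ^^ n) A)"
  proof
    assume "inj (\<lambda>n::nat. restrict (s ^^ n) A)"
    moreover have "range (\<lambda>n::nat. restrict (s ^^ n) A) \<subseteq> A \<rightarrow>\<^sub>E A"
      using maps by auto
    moreover have "finite (A \<rightarrow>\<^sub>E A)"
      using assms(1) by (intro finite_PiE) auto
    ultimately show False
      using finite_subset finite_imageD infinite_UNIV_nat by metis
  qed
  then obtain i j :: nat where "i < j" "restrict (s ^^ i) A = restrict (s ^^ j) A"
    unfolding inj_def by (metis linorder_neqE_nat)
  then have ij: "(s ^^ i) x = (s ^^ j) x" if "x \<in> A" for x
    using that by (metis restrict_apply')
  define d where "d = j - i"
  have d: "d \<ge> 1" "j = i + d"
    using \<open>i < j\<close> by (auto simp: d_def)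
  have step: "(s ^^ (n + d)) x = (s ^^ n) x" if "n \<ge> i" "x \<in> A" for n x
  proof -
    have "(s ^^ (n + d)) x = (s ^^ (n - i)) ((s ^^ j) x)"
      using that d by (simp flip: funpow_add comp_apply[of "s ^^ (n - i)"])
    also have "\<dots> = (s ^^ (n - i)) ((s ^^ i) x)"
      using ij that by simp
    also have "\<dots> = (s ^^ n) x"
      using that by (simp flip: funpow_add comp_apply[of "s ^^ (n - i)"])
    finally show ?thesis .
  qed
  have steps: "(s ^^ (n + k * d)) x = (s ^^ n) x" if "n \<ge> i" "x \<in> A" for n k x
  proof (induction k)
    case (Suc k)
    have "(s ^^ (n + Suc k * d)) x = (s ^^ ((n + k * d) + d)) x"
      by (simp add: algebra_simps)
    also have "\<dots> = (s ^^ (n + k * d)) x"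
      using that by (intro step) auto
    finally show ?case
      using Suc by simp
  qed auto
  show thesis
  proof (rule that[of "Suc i * d"])
    show "Suc i * d \<ge> 1"
      using d by simp
    fix x assume "x \<in> A"
    moreover have "Suc i * d \<ge> i"
      using d by (metis Suc_leD le_refl mult.right_neutral mult_le_mono)
    ultimately have "(s ^^ (Suc i * d + Suc i * d)) x = (s ^^ (Suc i * d)) x"
      by (rule steps[rotated])
    then show "(s ^^ (2 * (Suc i * d))) x = (s ^^ (Suc i * d)) x"
      by (simp only: mult_2)
  qed
qed

text \<open>\<open>A\<close> is the kernel together with \<open>f\<close>, closed under passing to
  subsequences along residue classes. Some power \<open>q\<close> of \<open>q0\<close> makes the
  shift by \<open>q\<close> idempotent on \<open>A\<close>, so that one zero digit acts like
  many.\<close>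

lemma automatic_imp_digit_colouring:
  assumes q0: "q0 \<ge> 2" and aut: "q_automatic q0 f"
  obtains q and kap :: "nat \<Rightarrow> (nat \<Rightarrow> complex) \<Rightarrow> nat \<Rightarrow> complex"
  where "digit_colouring q kap f"
proof -
  define A where "A = {(\<lambda>n. f (q0 ^ i * n + r)) | i r. r < q0 ^ i}"
  have "A \<subseteq> insert f (q_kernel q0 f)"
  proof
    fix h assume "h \<in> A"
    then obtain i r where h: "h = (\<lambda>n. f (q0 ^ i * n + r))" and r: "r < q0 ^ i"
      by (auto simp: A_def)
    show "h \<in> insert f (q_kernel q0 f)"
    proof (cases "i = 0")
      case True
      then show ?thesis using h r by simp
    next
      case False
      then have "i \<ge> 1" "r \<le> q0 ^ i - 1" using r by auto
      then show ?thesis using h unfolding q_kernel_def by blast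
    qed
  qed
  then have finA: "finite A"
    using aut unfolding q_automatic_def by (meson finite_insert finite_subset)
  have block: "(\<lambda>n. h (q0 ^ j * n + s)) \<in> A" if "h \<in> A" "s < q0 ^ j" for h j s
  proof -
    from that(1) obtain i r where h: "h = (\<lambda>n. f (q0 ^ i * n + r))" and r: "r < q0 ^ i"
      by (auto simp: A_def)
    have "q0 ^ i * s + r < q0 ^ (i + j)"
    proof -
      have "q0 ^ i * s + r < q0 ^ i * (s + 1)"
        using r by simp
      also have "\<dots> \<le> q0 ^ i * q0 ^ j"
        using that(2) by (intro mult_left_mono) auto
      finally show ?thesis by (simp add: power_add)
    qed
    moreover have "(\<lambda>n. h (q0 ^ j * n + s)) = (\<lambda>n. f (q0 ^ (i + j) * n + (q0 ^ i * s + r)))"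
      unfolding h by (simp add: algebra_simps power_add)
    ultimately show ?thesis
      unfolding A_def by blast
  qed
  define shift where "shift = (\<lambda>(h::nat \<Rightarrow> complex) n. h (q0 * n))"
  have "shift h \<in> A" if "h \<in> A" for h
    using block[OF that, of 0 1] q0 by (simp add: shift_def)
  then have "shift ` A \<subseteq> A"
    by blast
  then obtain z where z: "z \<ge> 1"
    and idem: "\<And>h. h \<in> A \<Longrightarrow> (shift ^^ (2 * z)) h = (shift ^^ z) h"
    using idempotent_iterate[OF finA] by metis
  have shift_app: "shift h n = h (q0 * n)" for h n
    by (simp add: shift_def)
  have shift_pow: "(shift ^^ k) h n = h (q0 ^ k * n)" for k h n
  proof (induction k arbitrary: n)
    case (Suc k)
    then show ?case by (simp add: shift_app ac_simps)
  qed simp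
  define q where "q = q0 ^ z"
  have q2: "q \<ge> 2"
    using q0 z unfolding q_def by (metis One_nat_def Suc_le_eq le_trans power_increasing power_one_right Suc_1 less_imp_le_nat zero_less_Suc)
  have qq: "h (q * (q * n)) = h (q * n)" if "h \<in> A" for h n
    using fun_cong[OF idem[OF that], of n]
    by (simp add: shift_pow q_def mult_2 power_add mult.assoc)
  have blockq: "(\<lambda>n. h (q ^ j * n + s)) \<in> A" if "h \<in> A" "s < q ^ j" for h j s
    using block[OF that(1), of s "z * j"] that(2) by (simp add: q_def power_mult)
  have gap1: "h (q ^ j * n + r) = h (q ^ Suc i * n + r)" if "h \<in> A" "r < q ^ i" "i < j" for h n r i j
  proof -
    have "i < j" by fact
    then have "Suc i \<le> j" by simp
    then show ?thesis
    proof (induction j arbitrary: n rule: dec_induct)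
      case (step k)
      let ?h = "\<lambda>n. h (q ^ i * n + r)"
      have "?h \<in> A" using blockq that by blast
      \<comment> \<open>Idempotence, applied to the subsequence \<open>?h\<close>, removes one zero
        digit of the gap.\<close>
      then have "?h (q * (q * (q ^ (k - Suc i) * n))) = ?h (q * (q ^ (k - Suc i) * n))"
        by (rule qq)
      moreover obtain d where "k = Suc i + d"
        using step(1) le_Suc_ex by blast
      then have "q ^ i * (q * (q * (q ^ (k - Suc i) * n))) = q ^ Suc k * n"
        "q ^ i * (q * (q ^ (k - Suc i) * n)) = q ^ k * n"
        by (simp_all add: power_add)
      ultimately show ?case using step by simp
    qed auto
  qed
  have self: "s < q ^ s" for s :: nat
    using q2 by (simp add: power_gt_expt)
  \<comment> \<open>A colour is the action on \<open>A\<close> of the digits of \<open>s\<close>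
    topped by zeros. As \<open>s < q ^ s\<close>, the exponent \<open>Suc s\<close> leaves a zero
    above \<open>s\<close>; any other exponent that does so gives the same map.\<close>
  define kap where "kap = (\<lambda>s. \<lambda>h\<in>A. \<lambda>n. h (q ^ Suc s * n + s))"
  have kap_iff: "kap s = kap t \<longleftrightarrow> (\<forall>h\<in>A. \<forall>n. h (q ^ j * n + s) = h (q ^ k * n + t))"
    if "s < q ^ i" "i < j" "t < q ^ l" "l < k" for s t i j l k
  proof -
    have ends: "h (q ^ Suc s * n + s) = h (q ^ j * n + s)" "h (q ^ Suc t * n + t) = h (q ^ k * n + t)"
      if "h \<in> A" for h n
      using gap1[OF that self[of s], where j="max (Suc s) j" and n=n]
        gap1[OF that \<open>s < q ^ i\<close>, where j="max (Suc s) j" and n=n]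
        gap1[OF that self[of t], where j="max (Suc t) k" and n=n]
        gap1[OF that \<open>t < q ^ l\<close>, where j="max (Suc t) k" and n=n]
        gap1[OF that \<open>s < q ^ i\<close> \<open>i < j\<close>, where n=n]
        gap1[OF that \<open>t < q ^ l\<close> \<open>l < k\<close>, where n=n]
        \<open>i < j\<close> \<open>l < k\<close> by (auto simp: less_max_iff_disj)
    moreover have "kap s = kap t \<longleftrightarrow> (\<forall>h\<in>A. \<forall>n. h (q ^ Suc s * n + s) = h (q ^ Suc t * n + t))"
      unfolding kap_def restrict_def fun_eq_iff by (auto split: if_splits)
    ultimately show ?thesis by (simp only: ends cong: ball_cong)
  qed
  have fA: "f \<in> A"
    unfolding A_def by (rule CollectI, rule exI[of _ 0], rule exI[of _ 0]) auto
  have "digit_colouring q kap f"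
  proof
    show "q \<ge> 2" by fact
    have "range kap \<subseteq> A \<rightarrow>\<^sub>E A"
    proof (clarsimp simp: kap_def)
      fix s h assume "h \<in> A"
      moreover have "s < q ^ Suc s"
        using self[of s] q2 by (metis less_le_trans mult_le_mono1 nat_mult_1 one_le_numeral order_trans power_Suc)
      ultimately show "(\<lambda>n. h (q * q ^ s * n + s)) \<in> A"
        using blockq[of h s "Suc s"] by simp
    qed
    then show "finite (range kap)"
      using finA by (meson finite_PiE finite_subset)
  next
    fix r r' i j m
    assume eq: "kap r = kap r'" and r: "r < q ^ i" "r' < q ^ i" and j: "i < j"
    have lt: "x + q ^ j * m < q ^ (j + m)" if "x < q ^ i" for x
    proof -
      have "x < q ^ j" using that j q2 by (meson le_less_trans less_le_trans nat_less_le power_increasing one_le_numeral order_trans)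
      then have "x + q ^ j * m < q ^ j * (m + 1)" by simp
      also have "\<dots> \<le> q ^ j * q ^ m" using self[of m] by (intro mult_left_mono) auto
      finally show ?thesis by (simp add: power_add)
    qed
    have *: "q ^ Suc (j + m) * n + (x + q ^ j * m) = q ^ j * (q ^ Suc m * n + m) + x" for n x
      by (simp add: algebra_simps power_add)
    show "kap (r + q ^ j * m) = kap (r' + q ^ j * m)"
      unfolding kap_iff[OF lt[OF r(1)] lessI lt[OF r(2)] lessI] *
      using eq kap_iff[OF r(1) j r(2) j] by blast
  next
    fix m m' r i assume eq: "kap m = kap m'" and r: "r < q ^ i"
    have lt: "r + q ^ i * m < q ^ (i + m)" for m
    proof -
      have "r + q ^ i * m < q ^ i * (m + 1)" using r by simp
      also have "\<dots> \<le> q ^ i * q ^ m" using self[of m] by (intro mult_left_mono) auto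
      finally show ?thesis by (simp add: power_add)
    qed
    have *: "q ^ Suc (i + m) * n + (r + q ^ i * m) = q ^ i * (q ^ Suc m * n + m) + r" for m n
      by (simp add: algebra_simps power_add)
    show "kap (r + q ^ i * m) = kap (r + q ^ i * m')"
      unfolding kap_iff[OF lt lessI lt lessI] *
    proof (intro ballI allI)
      fix h n assume "h \<in> A"
      then have "(\<lambda>n. h (q ^ i * n + r)) \<in> A" using r blockq by blast
      from bspec[OF kap_iff[OF self lessI self lessI, THEN iffD1, OF eq] this]
      show "h (q ^ i * (q ^ Suc m * n + m) + r) = h (q ^ i * (q ^ Suc m' * n + m') + r)"
        by blast
    qed
  next
    fix r i j k m assume r: "r < q ^ i" and j: "i < j" and k: "i < k"
    have lt: "r + q ^ j * m < q ^ (j + m)" if "i < j" for j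
    proof -
      have "r < q ^ j" using r that q2 by (meson less_le_trans less_imp_le_nat power_increasing one_le_numeral order_trans)
      then have "r + q ^ j * m < q ^ j * (m + 1)" by simp
      also have "\<dots> \<le> q ^ j * q ^ m" using self[of m] by (intro mult_left_mono) auto
      finally show ?thesis by (simp add: power_add)
    qed
    have *: "q ^ Suc (j + m) * n + (r + q ^ j * m) = q ^ j * (q ^ Suc m * n + m) + r" for n j
      by (simp add: algebra_simps power_add)
    show "kap (r + q ^ j * m) = kap (r + q ^ k * m)"
      unfolding kap_iff[OF lt[OF j] lessI lt[OF k] lessI] *
      by (intro ballI allI) (rule trans[OF gap1[OF _ r j] gap1[OF _ r k, symmetric]])
  next
    fix m n assume "kap m = kap n"
    then have "f (q ^ Suc m * 0 + m) = f (q ^ Suc n * 0 + n)"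
      using bspec[OF kap_iff[OF self lessI self lessI, THEN iffD1] fA] by blast
    then show "f m = f n" by simp
  qed
  then show thesis by (rule that)
qed

section \<open>Nonvanishing on prime powers\<close>

lemma multiplicative_prod_primes:
  assumes f: "multiplicative f" "f 1 = 1" and "finite S" and "\<And>p. p \<in> S \<Longrightarrow> prime p"
  shows "f (\<Prod>S) = (\<Prod>p\<in>S. f p)"
  using assms(3,4)
proof (induction rule: finite_induct)
  case (insert p S)
  have "coprime p (\<Prod>S)"
    using insert by (intro prod_coprime_right primes_coprime) auto
  moreover have "p > 0" "\<Prod>S > 0"
    using insert prime_gt_0_nat by (auto intro!: prod_pos)
  ultimately have "f (p * \<Prod>S) = f p * f (\<Prod>S)"
    using f unfolding multiplicative_def by blast
  then show ?case
    using insert by simp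
qed (use f in auto)

lemma multiplicative_nonzero:
  assumes f: "multiplicative f" "f 1 = 1"
    and pp: "\<And>p e. prime p \<Longrightarrow> p dvd n \<Longrightarrow> f (p ^ e) \<noteq> 0" and "n > 0"
  shows "f n \<noteq> 0"
  using pp \<open>n > 0\<close>
proof (induction n rule: less_induct)
  case (less n)
  show ?case
  proof (cases "n = 1")
    case False
    then obtain p where p: "prime p" "p dvd n"
      by (metis prime_factor_nat)
    then have "\<not> is_unit p" "n \<noteq> 0"
      using less by auto
    then obtain m where m: "n = p ^ multiplicity p n * m" "\<not> p dvd m"
      using multiplicity_decompose' by metis
    have e: "multiplicity p n > 0"
      using p less by (simp add: prime_multiplicity_gt_zero_iff)
    have "m > 0"
      using m less by (metis gr0I mult_0_right)
    moreover have "coprime (p ^ multiplicity p n) m"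
      using m p by (simp add: prime_imp_coprime)
    moreover have "p ^ multiplicity p n > 0"
      using p by (simp add: prime_gt_0_nat)
    ultimately have "f n = f (p ^ multiplicity p n) * f m"
      using f m(1) unfolding multiplicative_def by metis
    moreover have "m < n"
    proof -
      have "p ^ multiplicity p n > 1"
        using e p prime_gt_1_nat one_less_power by blast
      then have "1 * m < p ^ multiplicity p n * m"
        using \<open>m > 0\<close> by (intro mult_strict_right_mono)
      then show ?thesis
        using m(1) by simp
    qed
    moreover have "f m \<noteq> 0"
      using less.IH[OF \<open>m < n\<close>] less.prems(1) \<open>m > 0\<close> m(1) by (metis dvd_mult)
    ultimately show ?thesis
      using less.prems(1) p by simp
  qed (use f in auto)
qed

section \<open>Nonvanishing values of the form \<open>f (1 + q ^ 2 * a)\<close>\<close>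

locale multiplicative_colouring = digit_colouring q kap f
  for q and kap :: "nat \<Rightarrow> 'c" and f +
  assumes mult: "multiplicative f"
    and infinite_primes: "infinite {p. prime p \<and> f p \<noteq> 0}"
begin

lemma mult_coprime: "\<lbrakk>m > 0; n > 0; coprime m n\<rbrakk> \<Longrightarrow> f (m * n) = f m * f n"
  using mult unfolding multiplicative_def by blast

lemma f_1: "f 1 = 1"
proof -
  have "{p. prime p \<and> f p \<noteq> 0} \<noteq> {}"
    using infinite_primes by force
  then obtain p where "prime p" "f p \<noteq> 0"
    by blast
  then show ?thesis
    using mult_coprime[of p 1] by (simp add: prime_gt_0_nat)
qed

lemma gap_one: "i > 1 \<Longrightarrow> kap (1 + q ^ i * m) = kap (1 + q ^ 2 * m)"
  by (rule gap[of 1 1]) (use q2 in auto)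

lemma less_power_q: "n < q ^ n"
  using q2 by (simp add: power_gt_expt)

text \<open>Infinitely many primes with \<open>f p\<close> nonzero share a residue class modulo
  \<open>q ^ 2\<close>; by Euler's theorem the product of \<open>totient (q ^ 2)\<close> of them is
  1 modulo \<open>q ^ 2\<close>. Primes up to \<open>max b q\<close> are discarded, so the class is
  a unit and all factors exceed \<open>b\<close>.\<close>

lemma exists_nonzero_cong_1:
  "\<exists>a\<ge>1. f (1 + q ^ 2 * a) \<noteq> 0 \<and> (\<forall>p. prime p \<longrightarrow> p dvd 1 + q ^ 2 * a \<longrightarrow> p > b)"
proof -
  let ?P = "{p. prime p \<and> f p \<noteq> 0} - {..max b q}"
  have "infinite ?P"
    using infinite_primes by (intro Diff_infinite_finite) auto
  moreover have "(\<lambda>p. p mod q ^ 2) ` ?P \<subseteq> {..<q ^ 2}"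
    using q2 by auto
  then have "finite ((\<lambda>p. p mod q ^ 2) ` ?P)"
    by (rule finite_subset) auto
  ultimately obtain p0 where p0: "p0 \<in> ?P" and inf: "infinite {p \<in> ?P. p mod q ^ 2 = p0 mod q ^ 2}"
    using pigeonhole_infinite[of ?P "\<lambda>p. p mod q ^ 2"] by blast
  obtain S where S: "finite S" "card S = totient (q ^ 2)" "S \<subseteq> {p \<in> ?P. p mod q ^ 2 = p0 mod q ^ 2}"
    using infinite_arbitrarily_large[OF inf] by blast
  define n where "n = \<Prod>S"
  have primes: "prime p" "f p \<noteq> 0" "p > b" "[p = p0] (mod q ^ 2)" if "p \<in> S" for p
    using S that by (auto simp: cong_def)
  have cop: "coprime p0 (q ^ 2)"
  proof -
    have "\<not> p0 dvd q"
      using p0 q2 by (auto dest: dvd_imp_le)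
    then show ?thesis
      using p0 by (simp add: prime_imp_coprime)
  qed
  have "[n = (\<Prod>p\<in>S. p0)] (mod q ^ 2)"
    unfolding n_def using primes by (intro cong_prod) auto
  also have "(\<Prod>p\<in>S. p0) = p0 ^ totient (q ^ 2)"
    using S by simp
  also have "[\<dots> = 1] (mod q ^ 2)"
    using cop by (rule euler_theorem)
  finally have n1: "[n = 1] (mod q ^ 2)" .
  have "S \<noteq> {}"
    using S q2 by auto
  then obtain p1 where p1: "p1 \<in> S" by blast
  have "n > 0"
    unfolding n_def using primes prime_gt_0_nat by (auto intro!: prod_pos)
  moreover have "p1 dvd n"
    unfolding n_def using p1 S by (simp add: dvd_prodI[where f="\<lambda>x. x", simplified])
  ultimately have "n > 1"
    using primes(1)[OF p1] prime_gt_1_nat by (meson dvd_imp_le less_le_trans)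
  then obtain a where a: "n = 1 + q ^ 2 * a"
    using cong_to_1_nat[OF n1] by (metis add_diff_inverse_nat dvdE less_imp_not_less)
  have "a \<ge> 1"
    using a \<open>n > 1\<close> by (cases a) auto
  moreover have "f n \<noteq> 0"
    unfolding n_def using multiplicative_prod_primes[OF mult f_1 S(1)] primes S(1) by auto
  moreover have "p > b" if "prime p" "p dvd n" for p
  proof -
    obtain p' where "p' \<in> S" "p dvd p'"
      using \<open>prime p\<close> \<open>p dvd n\<close> S(1) unfolding n_def by (auto simp: prime_dvd_prod_iff)
    then show ?thesis
      using primes \<open>prime p\<close> by (metis primes_dvd_imp_eq)
  qed
  ultimately show ?thesis
    using a by blast
qed

lemma exists_nonzero_same_colour:
  obtains A where "\<And>a. a \<in> A \<Longrightarrow> f (1 + q ^ 2 * a) \<noteq> 0" "\<And>a. a \<in> A \<Longrightarrow> a \<ge> 1"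
    and "\<And>a a'. a \<in> A \<Longrightarrow> a' \<in> A \<Longrightarrow> kap a = kap a'"
    and "\<And>b. \<exists>a\<in>A. \<forall>p. prime p \<longrightarrow> p dvd 1 + q ^ 2 * a \<longrightarrow> p > b"
proof -
  obtain g where g: "\<And>b. g b \<ge> 1 \<and> f (1 + q ^ 2 * g b) \<noteq> 0 \<and>
      (\<forall>p. prime p \<longrightarrow> p dvd 1 + q ^ 2 * g b \<longrightarrow> p > b)"
    using exists_nonzero_cong_1 by metis
  have "finite (range (\<lambda>b. kap (g b)))"
    using finite_colours by (rule finite_subset[rotated]) auto
  then obtain b0 where b0: "infinite {b \<in> UNIV. kap (g b) = kap (g b0)}"
    using pigeonhole_infinite[of UNIV "\<lambda>b. kap (g b)"] by auto
  let ?A = "g ` {b. kap (g b) = kap (g b0)}"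
  show thesis
  proof (rule that[of ?A])
    fix b
    obtain b' where "b' > b" "kap (g b') = kap (g b0)"
      using b0 unfolding infinite_nat_iff_unbounded by auto
    then show "\<exists>a\<in>?A. \<forall>p. prime p \<longrightarrow> p dvd 1 + q ^ 2 * a \<longrightarrow> p > b"
      using g[of b'] by (intro bexI[of _ "g b'"]) auto
  qed (use g in auto)
qed

text \<open>Greedy choice: all prime factors of the next number exceed the product of the earlier
  ones.\<close>

lemma coprime_sequence:
  assumes "\<And>b. \<exists>a\<in>A. \<forall>p. prime p \<longrightarrow> p dvd 1 + q ^ 2 * a \<longrightarrow> p > b"
  shows "\<exists>a::nat \<Rightarrow> nat. (\<forall>i<L. a i \<in> A) \<and> (\<forall>l<L. \<forall>i<l. coprime (1 + q ^ 2 * a i) (1 + q ^ 2 * a l))"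
proof (induction L)
  case (Suc L)
  then obtain a where a: "\<forall>i<L. a i \<in> A" "\<forall>l<L. \<forall>i<l. coprime (1 + q ^ 2 * a i) (1 + q ^ 2 * a l)"
    by (elim exE conjE) (rule that)
  define B where "B = (\<Prod>i<L. 1 + q ^ 2 * a i)"
  obtain x where x: "x \<in> A" "\<forall>p. prime p \<longrightarrow> p dvd 1 + q ^ 2 * x \<longrightarrow> p > B"
    using assms[of B] by (elim bexE) (rule that)
  have "coprime (1 + q ^ 2 * a i) (1 + q ^ 2 * x)" if "i < L" for i
  proof (rule ccontr)
    assume "\<not> coprime (1 + q ^ 2 * a i) (1 + q ^ 2 * x)"
    then obtain c where c: "c dvd 1 + q ^ 2 * a i" "c dvd 1 + q ^ 2 * x" "\<not> is_unit c"
      by (rule not_coprimeE)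
    then obtain p where "prime p" "p dvd c"
      by (metis nat_dvd_1_iff_1 prime_factor_nat)
    then have p: "prime p" "p dvd 1 + q ^ 2 * a i" "p dvd 1 + q ^ 2 * x"
      using c by (auto intro: dvd_trans)
    have "1 + q ^ 2 * a i dvd B"
      unfolding B_def using that by (intro dvd_prodI) auto
    moreover have "B > 0"
      unfolding B_def by (intro prod_pos) auto
    ultimately have "p \<le> B"
      using p(2) by (meson dvd_imp_le dvd_trans)
    then show False
      using x(2) p(1,3) by (metis leD)
  qed
  then show ?case
    by (intro exI[of _ "a(L := x)"]) (use a x in \<open>auto simp: less_Suc_eq\<close>)
qed auto
end

lemma coprime_one_plus:
  fixes d m :: nat
  assumes "d dvd m"
  shows "coprime d (1 + m)"
proof (rule coprimeI)
  fix c assume "c dvd d" "c dvd 1 + m"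
  then show "is_unit c"
    using assms by (meson dvd_add_left_iff dvd_trans)
qed

context multiplicative_colouring
begin

text \<open>If the linear coefficients \<open>a i\<close> of \<open>\<Prod>i<L. 1 + a i * X i\<close> are replaced by other numbers
  of the same colour, the value of \<open>f\<close> does not change. The powers \<open>X i\<close> of \<open>q\<close> are chosen so
  far apart that the base-\<open>q\<close> digits of the monomials do not overlap.\<close>
lemma product_with_free_coefficients:
  fixes a :: "nat \<Rightarrow> nat" and L :: nat
  assumes a: "\<And>i. i < L \<Longrightarrow> f (1 + q ^ 2 * a i) \<noteq> 0" "\<And>i. i < L \<Longrightarrow> kap (a i) = col"
    and B: "finite B" "\<And>x. x \<in> B \<Longrightarrow> kap x = col"
    and cop: "\<And>i l. l < L \<Longrightarrow> i < l \<Longrightarrow> coprime (1 + q ^ 2 * a i) (1 + q ^ 2 * a l)"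
    and W: "coprime q W" "W > 0"
  shows "\<exists>X C N. f N \<noteq> 0 \<and> (\<forall>i<L. [X i = q ^ 2] (mod W)) \<and>
    (\<forall>b. (\<forall>i<L. b i \<in> B) \<longrightarrow> kap (C + (\<Sum>i<L. b i * X i)) = kap N)"
proof -
  define n where "n i = 1 + q ^ 2 * a i" for i
  \<comment> \<open>\<open>q ^ J\<close> exceeds every coefficient with a zero digit to spare, as
    \<open>low\<close> requires.\<close>
  define J where "J = Suc (Max (B \<union> a ` {..<L}))"
  have J: "x < q ^ (J - 1)" if "x \<in> B \<or> (\<exists>i<L. x = a i)" for x
  proof -
    have "x \<le> Max (B \<union> a ` {..<L})"
      using that B(1) by (intro Max_ge) auto
    also have "\<dots> < q ^ Max (B \<union> a ` {..<L})"
      by (rule less_power_q)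
    finally show ?thesis by (simp add: J_def)
  qed
  \<comment> \<open>\<open>N\<close> is the product of the first \<open>l\<close> spread-out
    factors. It stays 1 modulo \<open>q ^ J\<close>, so that the next coefficient stands alone in
    the lowest digits of \<open>N * a l\<close>, and coprime to the factors still to come.\<close>
  have "l \<le> L \<Longrightarrow> \<exists>X C N Z. N = 1 + q ^ J * Z \<and> coprime N (\<Prod>i\<in>{l..<L}. n i) \<and> f N \<noteq> 0 \<and>
    (\<forall>i<l. [X i = q ^ 2] (mod W)) \<and>
    (\<forall>b. (\<forall>i<l. b i \<in> B) \<longrightarrow> kap (C + (\<Sum>i<l. b i * X i)) = kap N)" for l
  proof (induction l)
    case 0
    have "1 = 1 + q ^ J * 0" "coprime 1 (\<Prod>i\<in>{0..<L}. n i)" "f 1 \<noteq> 0"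
      using f_1 by auto
    then show ?case
      by (intro exI[of _ "\<lambda>_. 0"] exI[of _ 1] exI[of _ 0]) auto
  next
    case (Suc l)
    then have l: "l < L" by simp
    from Suc.IH[OF less_imp_le_nat[OF l]] obtain X C N Z where N: "N = 1 + q ^ J * Z"
      and copN: "coprime N (\<Prod>i\<in>{l..<L}. n i)" and fN: "f N \<noteq> 0"
      and X: "\<forall>i<l. [X i = q ^ 2] (mod W)"
      and free: "\<forall>b. (\<forall>i<l. b i \<in> B) \<longrightarrow> kap (C + (\<Sum>i<l. b i * X i)) = kap N"
      by (elim exE conjE) (rule that)
    define V where "V = N * W * (\<Prod>i\<in>{Suc l..<L}. n i)"
    define U where "U = N + C + Max (insert 0 B) * (\<Sum>i<l. X i)"
    \<comment> \<open>Being 2 modulo \<open>totient V\<close>, \<open>j\<close> gives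
      \<open>q ^ j\<close> the residue of \<open>q ^ 2\<close> modulo \<open>V\<close>, which
      preserves residues modulo \<open>W\<close> and the coprimality of the factors. The factor
      \<open>J + U\<close> pushes \<open>j\<close> beyond the digits of \<open>N\<close> and of
      every admissible sum.\<close>
    define j where "j = totient V * (J + U) + 2"
    have q_n: "coprime q (n i)" for i
      unfolding n_def by (intro coprime_one_plus) auto
    have q_N: "coprime q N"
      unfolding N by (intro coprime_one_plus) (simp add: J_def)
    have "coprime q V"
      unfolding V_def using q_n q_N W(1) by (auto intro: prod_coprime_right)
    then have "[q ^ totient V = 1] (mod V)"
      by (rule euler_theorem)
    then have "[(q ^ totient V) ^ (J + U) * q ^ 2 = 1 ^ (J + U) * q ^ 2] (mod V)"
      by (intro cong_mult cong_pow cong_refl)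
    then have qj: "[q ^ j = q ^ 2] (mod V)"
      unfolding j_def by (simp only: power_add power_mult power_one mult_1)
    have "V > 0"
    proof -
      have "N > 0" "(\<Prod>i\<in>{Suc l..<L}. n i) > 0"
        by (auto simp: N n_def intro!: prod_pos)
      then show ?thesis using W by (simp add: V_def)
    qed
    then have "totient V \<ge> 1"
      by (simp add: Suc_leI)
    then have "1 * (J + U) \<le> totient V * (J + U)"
      by (intro mult_right_mono) auto
    then have j: "j > J + U"
      unfolding j_def mult_1 by (rule le_less_trans) simp
    have j1: "j > 1"
      by (simp add: j_def)
    have U_small: "U < q ^ (J + U)"
      using less_power_q[of "J + U"] by linarith
    have "[n l = 1 + q ^ j * a l] (mod V)"
      unfolding n_def using qj by (intro cong_add cong_mult cong_refl) (rule cong_sym)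
    then have nl: "[n l = 1 + q ^ j * a l] (mod d)" if "d dvd V" for d
      using that by (rule cong_dvd_modulus_nat)
    have "{l..<L} = insert l {Suc l..<L}"
      using l by auto
    then have copl: "coprime N (n l)" "coprime N (\<Prod>i\<in>{Suc l..<L}. n i)"
      using copN by simp_all
    have cop1: "coprime N (1 + q ^ j * a l)"
      using cong_imp_coprime[OF nl[of N]] copl(1) by (simp add: V_def coprime_commute)
    have "coprime (n l) (\<Prod>i\<in>{Suc l..<L}. n i)"
      using cop unfolding n_def by (intro prod_coprime_right) auto
    then have cop2: "coprime (1 + q ^ j * a l) (\<Prod>i\<in>{Suc l..<L}. n i)"
      using cong_imp_coprime[OF nl[of "\<Prod>i\<in>{Suc l..<L}. n i"]] by (simp add: V_def)
    define N' where "N' = N * (1 + q ^ j * a l)"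
    have "f N' = f N * f (1 + q ^ j * a l)"
      unfolding N'_def using cop1 by (intro mult_coprime) (auto simp: N)
    also have "f (1 + q ^ j * a l) = f (1 + q ^ 2 * a l)"
      using gap_one[OF j1] by (intro colour_determines)
    finally have fN': "f N' \<noteq> 0"
      using fN a(1) l by simp
    have copN': "coprime N' (\<Prod>i\<in>{Suc l..<L}. n i)"
      unfolding N'_def coprime_mult_left_iff using copl cop2 by blast
    have N': "N' = 1 + q ^ J * (Z + q ^ (j - J) * a l * N)"
    proof -
      have "q ^ J * q ^ (j - J) = q ^ j"
        using j by (simp flip: power_add)
      then show ?thesis
        unfolding N'_def by (simp add: N algebra_simps)
    qed
    define X' where "X' = X(l := q ^ j)"
    \<comment> \<open>As \<open>N' = N + q ^ j * (a l + q ^ J * (Z * a l))\<close>, only the lowest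
      \<open>a l\<close> becomes free; the upper part stays in the constant
      \<open>C'\<close>.\<close>
    define C' where "C' = C + q ^ j * (q ^ J * (Z * a l))"
    have "[q ^ j = q ^ 2] (mod W)"
      using qj by (rule cong_dvd_modulus_nat) (simp add: V_def)
    then have X': "\<forall>i<Suc l. [X' i = q ^ 2] (mod W)"
      using X by (auto simp: X'_def less_Suc_eq)
    have free': "kap (C' + (\<Sum>i<Suc l. b i * X' i)) = kap N'" if b: "\<forall>i<Suc l. b i \<in> B" for b
    proof -
      define S where "S = C + (\<Sum>i<l. b i * X i)"
      have "(\<Sum>i<l. b i * X i) \<le> (\<Sum>i<l. Max (insert 0 B) * X i)"
        using b B(1) by (intro sum_mono mult_right_mono Max_ge) auto
      then have S: "S < q ^ (J + U)"
        using U_small by (auto simp: S_def U_def sum_distrib_left)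
      have NU: "N < q ^ (J + U)"
        using U_small by (auto simp: U_def)
      have "C' + (\<Sum>i<Suc l. b i * X' i) = S + q ^ j * (b l + q ^ J * (Z * a l))"
        by (simp add: C'_def X'_def S_def algebra_simps)
      also have "kap \<dots> = kap (N + q ^ j * (b l + q ^ J * (Z * a l)))"
        using free b j S NU by (intro low[of _ _ "J + U"]) (auto simp: S_def)
      also have "kap (b l + q ^ J * (Z * a l)) = kap (a l + q ^ J * (Z * a l))"
        using J b l a(2) B(2) by (intro low[of _ _ "J - 1"]) (auto simp: J_def)
      then have "kap (N + q ^ j * (b l + q ^ J * (Z * a l))) = kap (N + q ^ j * (a l + q ^ J * (Z * a l)))"
        using NU j q2 by (intro high) (auto intro: less_le_trans power_increasing)
      also have "N + q ^ j * (a l + q ^ J * (Z * a l)) = N'"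
        by (simp add: N'_def N algebra_simps)
      finally show ?thesis .
    qed
    show ?case
      by (rule exI[of _ X'], rule exI[of _ C'], rule exI[of _ N'], rule exI, intro conjI allI impI,
          rule N', rule copN', rule fN') (use X' free' in blast)+
  qed
  from this[OF le_refl] show ?thesis
    by (elim exE conjE) (intro exI conjI)
qed

text \<open>Two elements \<open>a < a'\<close> of one colour are interchangeable coefficients whose
  difference \<open>D\<close> is prime to every large \<open>p\<close>. If
  \<open>f (p ^ e) = 0\<close>, a suitable number of replacements leads from a product with nonzero
  value to a number exactly divisible by \<open>p ^ e\<close>, without changing
  \<open>f\<close>.\<close>

lemma prime_power_nonzero:
  "\<exists>B. \<forall>p e. prime p \<longrightarrow> p > B \<longrightarrow> f (p ^ e) \<noteq> 0"
proof -
  obtain A where A: "\<And>a. a \<in> A \<Longrightarrow> f (1 + q ^ 2 * a) \<noteq> 0" "\<And>a. a \<in> A \<Longrightarrow> a \<ge> 1"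
    "\<And>a a'. a \<in> A \<Longrightarrow> a' \<in> A \<Longrightarrow> kap a = kap a'"
    "\<And>b. \<exists>a\<in>A. \<forall>p. prime p \<longrightarrow> p dvd 1 + q ^ 2 * a \<longrightarrow> p > b"
    by (rule exists_nonzero_same_colour) (rule that)
  obtain a where a: "a \<in> A"
    using A(4) by blast
  obtain a' where a': "a' \<in> A" "\<forall>p. prime p \<longrightarrow> p dvd 1 + q ^ 2 * a' \<longrightarrow> p > 1 + q ^ 2 * a"
    using A(4)[of "1 + q ^ 2 * a"] by (elim bexE) (rule that)
  have "a < a'"
  proof -
    have "1 + q ^ 2 * a' \<noteq> 1"
      using A(2)[OF a'(1)] q2 by simp
    then obtain p where p: "prime p" "p dvd 1 + q ^ 2 * a'"
      by (metis prime_factor_nat)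
    then have "1 + q ^ 2 * a < p" "p \<le> 1 + q ^ 2 * a'"
      using a'(2) by (auto intro: dvd_imp_le)
    then have "q ^ 2 * a < q ^ 2 * a'"
      by linarith
    then show ?thesis by simp
  qed
  define D where "D = a' - a"
  have D: "D > 0" "a' = a + D"
    using \<open>a < a'\<close> by (auto simp: D_def)
  have "f (p ^ e) \<noteq> 0" if p: "prime p" "p > q + D" for p e
  proof
    assume zero: "f (p ^ e) = 0"
    \<comment> \<open>The modulus \<open>p ^ Suc e\<close> detects exact divisibility by
      \<open>p ^ e\<close>; taking \<open>W\<close> factors allows every number \<open>t < W\<close>
      of replacements.\<close>
    define W where "W = p ^ Suc e"
    have W: "W > 0"
      using p by (simp add: W_def prime_gt_0_nat)
    have "\<not> p dvd q" "\<not> p dvd D"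
      using p q2 D by (auto dest: dvd_imp_le)
    then have "coprime p q" "coprime p D"
      using p by (simp_all add: prime_imp_coprime)
    then have copW: "coprime q W" "coprime D W"
      by (simp_all add: W_def coprime_commute)
    obtain s where s: "\<forall>i<W. s i \<in> A"
      "\<forall>l<W. \<forall>i<l. coprime (1 + q ^ 2 * s i) (1 + q ^ 2 * s l)"
      using coprime_sequence[OF A(4), of W] by (elim exE conjE) (rule that)
    obtain X C N where N: "f N \<noteq> 0" and X: "\<forall>i<W. [X i = q ^ 2] (mod W)"
      and free: "\<forall>b. (\<forall>i<W. b i \<in> {a, a'}) \<longrightarrow> kap (C + (\<Sum>i<W. b i * X i)) = kap N"
    proof -
      have "\<exists>X C N. f N \<noteq> 0 \<and> (\<forall>i<W. [X i = q ^ 2] (mod W)) \<and>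
          (\<forall>b. (\<forall>i<W. b i \<in> {a, a'}) \<longrightarrow> kap (C + (\<Sum>i<W. b i * X i)) = kap N)"
      proof (rule product_with_free_coefficients[where a = s and col = "kap a"])
        show "f (1 + q ^ 2 * s i) \<noteq> 0" "kap (s i) = kap a" if "i < W" for i
          using s(1) that A(1,3) a by blast+
        show "kap x = kap a" if "x \<in> {a, a'}" for x
          using that A(3) a a'(1) by blast
      qed (use s copW W in auto)
      then show ?thesis
        by (elim exE conjE) (rule that)
    qed
    define K where "K = C + q ^ 2 * (a * W)"
    have "coprime (q ^ 2 * D) W"
      using copW by simp
    then obtain x where x: "[q ^ 2 * D * x = 1] (mod W)"
      by (metis cong_solve_coprime_nat One_nat_def)
    \<comment> \<open>\<open>t\<close> solves \<open>K + q ^ 2 * D * t = p ^ e\<close> modulo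
      \<open>W\<close>; the summand \<open>(W - 1) * K\<close> stands for
      \<open>- K\<close>.\<close>
    define t where "t = (x * (p ^ e + (W - 1) * K)) mod W"
    define b where "b i = (if i < t then a' else a)" for i
    have "t \<le> W"
      using W by (simp add: t_def less_imp_le)
    have "(\<Sum>i<W. b i) = (\<Sum>i<W. a + (if i < t then D else 0))"
      using D by (intro sum.cong) (auto simp: b_def)
    also have "\<dots> = a * W + D * card {i. i < W \<and> i < t}"
      by (simp add: sum.distrib sum.If_cases Int_def)
    also have "{i. i < W \<and> i < t} = {..<t}"
      using \<open>t \<le> W\<close> by auto
    finally have sum_b: "(\<Sum>i<W. b i) = a * W + D * t"
      by simp
    have "[C + (\<Sum>i<W. b i * X i) = C + (\<Sum>i<W. b i * q ^ 2)] (mod W)"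
      using X by (intro cong_add cong_sum cong_mult cong_refl) auto
    also have "C + (\<Sum>i<W. b i * q ^ 2) = K + q ^ 2 * D * t"
      unfolding K_def sum_distrib_right[symmetric] sum_b by (simp add: algebra_simps)
    also have "[K + q ^ 2 * D * t = K + q ^ 2 * D * (x * (p ^ e + (W - 1) * K))] (mod W)"
      unfolding t_def by (intro cong_add cong_mult cong_refl) (simp add: cong_def)
    also have "K + q ^ 2 * D * (x * (p ^ e + (W - 1) * K)) = K + q ^ 2 * D * x * (p ^ e + (W - 1) * K)"
      by (simp only: mult.assoc)
    also have "[\<dots> = K + 1 * (p ^ e + (W - 1) * K)] (mod W)"
      using x by (intro cong_add cong_mult cong_refl)
    also have "K + 1 * (p ^ e + (W - 1) * K) = p ^ e + W * K"
      using W by (cases W) (auto simp: algebra_simps)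
    also have "[p ^ e + W * K = p ^ e] (mod W)"
      by (simp add: cong_def)
    finally have "[C + (\<Sum>i<W. b i * X i) = p ^ e] (mod W)" .
    moreover have "p ^ e < W"
      using p prime_gt_1_nat by (simp add: W_def prime_gt_0_nat)
    ultimately have "(C + (\<Sum>i<W. b i * X i)) mod W = p ^ e"
      by (simp add: cong_def)
    then obtain v where "C + (\<Sum>i<W. b i * X i) = W * v + p ^ e"
      by (metis mult_div_mod_eq)
    then have v: "C + (\<Sum>i<W. b i * X i) = p ^ e * (1 + p * v)"
      by (simp add: W_def algebra_simps)
    have "f (p ^ e * (1 + p * v)) = f (p ^ e) * f (1 + p * v)"
      using p by (intro mult_coprime coprime_one_plus coprime_power_left_iff[THEN iffD2] disjI1)
        (auto simp: prime_gt_0_nat)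
    then have "f (C + (\<Sum>i<W. b i * X i)) = 0"
      using zero v by simp
    moreover have "kap (C + (\<Sum>i<W. b i * X i)) = kap N"
      using free by (simp add: b_def)
    ultimately show False
      using N colour_determines by metis
  qed
  then show ?thesis by blast
qed

text \<open>The factor \<open>fact B\<close> forces every prime not dividing \<open>Q\<close> above
  the bound \<open>B\<close> for prime powers. The factor \<open>q - 1\<close> serves the later
  comparison of \<open>q ^ j\<close> with \<open>q ^ Suc j\<close>.\<close>

lemma nonzero_on_coprimes:
  obtains Q where "Q > 1" "q dvd Q" "(q - 1) dvd Q" "\<And>n. \<lbrakk>n > 0; coprime n Q\<rbrakk> \<Longrightarrow> f n \<noteq> 0"
proof -
  obtain B where B: "\<forall>p e. prime p \<longrightarrow> p > B \<longrightarrow> f (p ^ e) \<noteq> 0"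
    using prime_power_nonzero by blast
  define Q where "Q = q * ((q - 1) * fact B)"
  have "f n \<noteq> 0" if n: "n > 0" "coprime n Q" for n
  proof (rule multiplicative_nonzero[OF mult f_1 _ n(1)])
    fix p e assume p: "prime p" "p dvd n"
    have "\<not> p dvd fact B"
    proof
      assume "p dvd fact B"
      then have "p dvd Q" by (simp add: Q_def)
      then show False
        using n p by (meson coprime_common_divisor not_prime_unit)
    qed
    then have "p > B"
      using p by (simp add: prime_dvd_fact_iff)
    then show "f (p ^ e) \<noteq> 0"
      using B p by blast
  qed
  moreover have "Q > 1"
  proof -
    have "Q \<ge> 2 * 1"
      unfolding Q_def using q2 by (intro mult_mono) (auto simp: Suc_le_eq)
    then show ?thesis by simp
  qed
  ultimately show thesis
    by (intro that[of Q]) (auto simp: Q_def)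
qed

end

section \<open>Complete multiplicativity\<close>

locale nonvanishing_colouring = multiplicative_colouring q kap f
  for q and kap :: "nat \<Rightarrow> 'c" and f +
  fixes Q :: nat
  assumes Q: "Q > 1" "q dvd Q" "(q - 1) dvd Q"
    and nonzero: "\<lbrakk>n > 0; coprime n Q\<rbrakk> \<Longrightarrow> f n \<noteq> 0"
begin

lemma pos: "coprime n Q \<Longrightarrow> n > 0"
  using Q by (cases n) auto

lemma coprime_1_plus_Q: "Q dvd m \<Longrightarrow> coprime (1 + m) Q"
  using coprime_one_plus coprime_commute by blast

lemma coprime_plus_Q: "\<lbrakk>coprime r Q; Q dvd m\<rbrakk> \<Longrightarrow> coprime (r + m) Q"
  by (metis cong_add_lcancel_0_nat cong_0_iff cong_imp_coprime cong_sym)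

text \<open>For a suitable \<open>t\<close>, \<open>1 + q ^ j * (Q * t)\<close> is exactly divisible
  by \<open>p ^ b\<close>, while the same number with \<open>Suc j\<close> for \<open>j\<close> is
  prime to \<open>p\<close>, since \<open>p\<close> does not divide \<open>q - 1\<close>.
  Lengthening the gap changes \<open>f\<close> neither at these numbers nor at \<open>p\<close>
  times them; comparing the values gives the claim.\<close>

lemma prime_power_step:
  assumes p: "prime p" "\<not> p dvd Q"
  shows "f (p ^ Suc b) = f p * f (p ^ b)"
proof (cases "b = 0")
  case False
  \<comment> \<open>The gap begins beyond the digits of \<open>p\<close>, so \<open>gap\<close>
    applies to the multiples by \<open>p\<close>.\<close>
  define j where "j = Suc p"
  have "\<not> p dvd q"
    using p Q by (meson dvd_trans)
  then have "coprime p q" "coprime p Q"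
    using p by (simp_all add: prime_imp_coprime)
  then have "coprime (q ^ j * Q) (p ^ Suc b)"
    by (simp add: coprime_commute)
  then obtain x where x: "[q ^ j * Q * x = 1] (mod p ^ Suc b)"
    by (metis cong_solve_coprime_nat One_nat_def)
  define t where "t = x * (p ^ b + (p ^ Suc b - 1))"
  have "[1 + q ^ j * (Q * t) = 1 + 1 * (p ^ b + (p ^ Suc b - 1))] (mod p ^ Suc b)"
    unfolding t_def mult.assoc[symmetric] using x by (intro cong_add cong_mult cong_refl)
  also have "1 + 1 * (p ^ b + (p ^ Suc b - 1)) = p ^ b + p ^ Suc b"
    using p by (simp add: prime_gt_0_nat)
  also have "[p ^ b + p ^ Suc b = p ^ b] (mod p ^ Suc b)"
    by (simp add: cong_def)
  finally have "(1 + q ^ j * (Q * t)) mod p ^ Suc b = p ^ b"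
    using prime_gt_1_nat[OF p(1)] by (simp add: cong_def)
  then obtain v where "1 + q ^ j * (Q * t) = p ^ Suc b * v + p ^ b"
    by (metis mult_div_mod_eq)
  then have v: "1 + q ^ j * (Q * t) = p ^ b * (1 + p * v)"
    by (simp add: algebra_simps)
  have "coprime (p ^ b * (1 + p * v)) Q"
    unfolding v[symmetric] by (rule coprime_1_plus_Q) auto
  then have u: "f (1 + p * v) \<noteq> 0"
    by (intro nonzero) (auto simp del: mult_Suc_right)
  have cop: "coprime (p ^ k) (1 + p * v)" for k
    by (intro coprime_power_left_iff[THEN iffD2] disjI1 coprime_one_plus) auto
  have pk: "p ^ k > 0" for k
    using p by (simp add: prime_gt_0_nat)
  have ndvd: "\<not> p dvd 1 + q ^ Suc j * (Q * t)"
  proof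
    define y where "y = q ^ j * (Q * t)"
    have 1: "p dvd 1 + y"
      unfolding y_def v using False by (simp add: dvd_power)
    assume "p dvd 1 + q ^ Suc j * (Q * t)"
    then have "p dvd 1 + q * y"
      by (simp add: y_def mult.assoc)
    moreover have "1 + q * y = (q - 1) * y + (1 + y)"
      using q2 by (cases q) auto
    ultimately have "p dvd (q - 1) * y"
      using 1 by (metis dvd_add_left_iff)
    moreover have "\<not> p dvd y"
      using 1 p by (metis dvd_add_left_iff not_prime_unit)
    ultimately have "p dvd Q"
      using p Q by (meson dvd_trans prime_dvd_mult_iff)
    then show False using p by blast
  qed
  have "f (p * (1 + q ^ j * (Q * t))) = f (p * (1 + q ^ Suc j * (Q * t)))"
  proof (rule colour_determines)
    have "kap (p + q ^ j * (p * (Q * t))) = kap (p + q ^ Suc j * (p * (Q * t)))"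
      by (rule gap[of p p]) (auto simp: j_def less_power_q)
    then show "kap (p * (1 + q ^ j * (Q * t))) = kap (p * (1 + q ^ Suc j * (Q * t)))"
      by (simp add: algebra_simps)
  qed
  also have "\<dots> = f p * f (1 + q ^ Suc j * (Q * t))"
    using p ndvd by (intro mult_coprime) (auto simp: prime_gt_0_nat prime_imp_coprime)
  also have "f (1 + q ^ Suc j * (Q * t)) = f (1 + q ^ j * (Q * t))"
    by (rule colour_determines) (use gap_one[of "Suc j"] gap_one[of j] p in \<open>auto simp: j_def prime_gt_0_nat\<close>)
  also have "\<dots> = f (p ^ b) * f (1 + p * v)"
    unfolding v using cop pk by (intro mult_coprime) auto
  finally have "f (p * (1 + q ^ j * (Q * t))) = f p * (f (p ^ b) * f (1 + p * v))" .
  moreover have "p * (1 + q ^ j * (Q * t)) = p ^ Suc b * (1 + p * v)"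
    unfolding v by (simp only: power_Suc mult.assoc)
  moreover have "f (p ^ Suc b * (1 + p * v)) = f (p ^ Suc b) * f (1 + p * v)"
    using cop pk by (intro mult_coprime) auto
  ultimately show ?thesis
    using u by simp
qed (simp add: f_1[simplified])

lemma prime_times:
  assumes p: "prime p" "\<not> p dvd Q" and n: "coprime n Q"
  shows "f (p * n) = f p * f n"
proof -
  have "\<not> is_unit p" "n \<noteq> 0"
    using p pos[OF n] by auto
  then obtain m where m: "n = p ^ multiplicity p n * m" "\<not> p dvd m"
    using multiplicity_decompose' by metis
  define b where "b = multiplicity p n"
  have "m > 0"
    using m \<open>n \<noteq> 0\<close> by (metis gr0I mult_0_right)
  have cop: "coprime (p ^ k) m" for k
    using m p by (simp add: prime_imp_coprime)
  have pk: "p ^ k > 0" for k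
    using p by (simp add: prime_gt_0_nat)
  have "f (p * n) = f (p ^ Suc b * m)"
    using m(1) by (simp add: b_def mult.assoc)
  also have "\<dots> = f (p ^ Suc b) * f m"
    using cop pk \<open>m > 0\<close> by (intro mult_coprime)
  also have "\<dots> = f p * (f (p ^ b) * f m)"
    using prime_power_step[OF p] by simp
  also have "f (p ^ b) * f m = f n"
    using cop pk \<open>m > 0\<close> m(1) mult_coprime by (metis b_def)
  finally show ?thesis .
qed

lemma completely_mult:
  assumes "coprime m Q" "coprime n Q"
  shows "f (m * n) = f m * f n"
  using assms(1)
proof (induction m rule: less_induct)
  case (less m)
  show ?case
  proof (cases "m = 1")
    case True
    then show ?thesis using f_1 by simp
  next
    case False
    then obtain p where p: "prime p" "p dvd m"
      by (metis prime_factor_nat)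
    then obtain k where k: "m = p * k" by blast
    have pQ: "\<not> p dvd Q" "coprime k Q"
      using p less.prems k by (meson coprime_common_divisor not_prime_unit) (use less.prems k in simp)
    have "k > 0" "p > 1"
      using pos[OF pQ(2)] p prime_gt_1_nat by auto
    then have "k < m"
      by (simp add: k)
    have "f (m * n) = f p * f (k * n)"
      unfolding k mult.assoc using p pQ assms(2) by (intro prime_times) auto
    also have "f (k * n) = f k * f n"
      using less.IH \<open>k < m\<close> pQ by blast
    finally show ?thesis
      using prime_times[OF p(1) pQ] by (simp add: k)
  qed
qed

end

section \<open>A functional equation on finite abelian groups\<close>

text \<open>In a finite group the inverse of \<open>x\<close> is a positive power of
  \<open>x\<close>.\<close>

lemma (in group) finite_subgroupI:
  assumes "finite (carrier G)" and H: "H \<subseteq> carrier G" "H \<noteq> {}"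
    and closed: "\<And>x y. \<lbrakk>x \<in> H; y \<in> H\<rbrakk> \<Longrightarrow> x \<otimes> y \<in> H"
  shows "subgroup H G"
proof (rule subgroupI[OF H _ closed])
  fix x assume x: "x \<in> H"
  have pow: "x [^] Suc n \<in> H" for n
  proof (induction n)
    case (Suc n)
    then have "x [^] Suc n \<otimes> x \<in> H"
      using x closed by blast
    then show ?case by simp
  qed (use x H in auto)
  obtain n where n: "order G = Suc n"
    using assms(1) order_gt_0_iff_finite not0_implies_Suc by blast
  \<comment> \<open>The exponent is \<open>2 * order G - 1\<close>, positive even in the trivial
    group.\<close>
  have "x [^] (order G + n) \<otimes> x = x [^] (order G + order G)"
    by (simp add: n)
  also have "\<dots> = \<one>"
    using x H pow_order_eq_1[of x] by (simp add: nat_pow_mult[symmetric] subset_iff)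
  finally have "inv x = x [^] (order G + n)"
    using x H by (intro inv_equality) auto
  then show "inv x \<in> H"
    using pow[of "n + n"] n by simp
qed

text \<open>The functional equation forces \<open>La\<close> to be a projection onto a direct factor.\<close>
lemma (in comm_group) projection_functional_equation:
  assumes fin: "finite (carrier G)" and La: "\<And>g. g \<in> carrier G \<Longrightarrow> La g \<in> carrier G"
    and eq: "\<And>g w. \<lbrakk>g \<in> carrier G; w \<in> carrier G\<rbrakk> \<Longrightarrow> La g \<otimes> La (w \<otimes> g) = La (g \<otimes> La (w \<otimes> La g))"
  shows "g \<in> carrier G \<Longrightarrow> La (La g) = La g"
    and "\<lbrakk>g \<in> carrier G; h \<in> carrier G\<rbrakk> \<Longrightarrow> La (g \<otimes> h) = La g \<otimes> La h"
proof -
  define I where "I = La ` carrier G"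
  define Z where "Z = {g \<in> carrier G. La g = \<one>}"
  have I: "subgroup I G"
  proof (rule finite_subgroupI[OF fin])
    fix x y assume "x \<in> I" "y \<in> I"
    then obtain g h where gh: "g \<in> carrier G" "h \<in> carrier G" "x = La g" "y = La h"
      by (auto simp: I_def)
    have "(h \<otimes> inv g) \<otimes> g = h"
      using gh by (simp add: m_assoc)
    then have "x \<otimes> y = La (g \<otimes> La ((h \<otimes> inv g) \<otimes> La g))"
      using eq[of g "h \<otimes> inv g"] gh by simp
    then show "x \<otimes> y \<in> I"
      unfolding I_def using gh La by auto
  qed (use La in \<open>auto simp: I_def\<close>)
  \<comment> \<open>The choice \<open>w = z \<otimes> inv (La g)\<close> turns the inner argument
    \<open>w \<otimes> La g\<close> into \<open>z\<close>, which \<open>La\<close> kills.\<close>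
  have twist: "La (z \<otimes> g \<otimes> inv (La g)) = \<one>" if z: "z \<in> Z" and g: "g \<in> carrier G" for z g
  proof -
    have zc: "z \<in> carrier G" "La z = \<one>"
      using z by (auto simp: Z_def)
    have "La g \<otimes> La ((z \<otimes> inv (La g)) \<otimes> g) = La (g \<otimes> La ((z \<otimes> inv (La g)) \<otimes> La g))"
      using g zc La by (intro eq) auto
    also have "(z \<otimes> inv (La g)) \<otimes> La g = z"
      using g zc La by (simp add: m_assoc)
    finally have "La g \<otimes> La ((z \<otimes> inv (La g)) \<otimes> g) = La g \<otimes> \<one>"
      using g zc La by simp
    then have "La ((z \<otimes> inv (La g)) \<otimes> g) = \<one>"
      using g zc La by (simp add: l_cancel_one)
    moreover have "(z \<otimes> inv (La g)) \<otimes> g = z \<otimes> g \<otimes> inv (La g)"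
      using g zc La by (simp add: m_ac)
    ultimately show ?thesis by simp
  qed
  have Z: "subgroup Z G"
  proof (rule finite_subgroupI[OF fin])
    have "\<one> \<in> I"
      using I by (rule subgroup.one_closed)
    then show "Z \<noteq> {}"
      by (auto simp: I_def Z_def)
  next
    fix x y assume xy: "x \<in> Z" "y \<in> Z"
    then show "x \<otimes> y \<in> Z"
      using twist[of x y] by (auto simp: Z_def)
  qed (auto simp: Z_def)
  have one: "\<one> \<in> Z"
    using Z by (rule subgroup.one_closed)
  have idem: "La (La g) = La g" if "g \<in> carrier G" for g
    using eq[of \<one> g] one that La by (simp add: Z_def)
  have fixed: "La i = i" if "i \<in> I" for i
    using that idem by (auto simp: I_def)
  have part: "g \<otimes> inv (La g) \<in> Z" if "g \<in> carrier G" for g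
    using twist[OF one that] that La by (simp add: Z_def)
  \<comment> \<open>\<open>i\<close> and \<open>i2 = La (z \<otimes> i)\<close> differ by an element
    of both \<open>I\<close> and \<open>Z\<close>, on which \<open>La\<close> is at once the
    identity and trivial.\<close>
  have proj: "La (z \<otimes> i) = i" if z: "z \<in> Z" and i: "i \<in> I" for z i
  proof -
    have c: "z \<in> carrier G" "i \<in> carrier G"
      using z i subgroup.subset[OF I] by (auto simp: Z_def)
    define i2 where "i2 = La (z \<otimes> i)"
    have i2: "i2 \<in> I" "i2 \<in> carrier G"
      using c La by (auto simp: i2_def I_def)
    have "z \<otimes> i \<otimes> inv i2 \<in> Z"
      using part[of "z \<otimes> i"] c by (simp add: i2_def)
    then have "inv z \<otimes> (z \<otimes> i \<otimes> inv i2) \<in> Z"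
      using Z z by (simp add: subgroup.m_closed subgroup.m_inv_closed)
    moreover have "inv z \<otimes> (z \<otimes> i \<otimes> inv i2) = i \<otimes> inv i2"
      using c i2 by (simp add: m_assoc flip: m_assoc[of "inv z" z])
    moreover have "La (i \<otimes> inv i2) = i \<otimes> inv i2"
      using I i i2 by (intro fixed) (simp add: subgroup.m_closed subgroup.m_inv_closed)
    ultimately have "i \<otimes> inv i2 = \<one>"
      by (simp add: Z_def)
    then have "i = i2"
      using c i2 by (metis inv_equality inv_closed inv_inv)
    then show ?thesis
      by (simp add: i2_def)
  qed
  show "g \<in> carrier G \<Longrightarrow> La (La g) = La g"
    by (rule idem)
  show "La (g \<otimes> h) = La g \<otimes> La h" if gh: "g \<in> carrier G" "h \<in> carrier G"
  proof -
    have c: "La g \<in> carrier G" "La h \<in> carrier G"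
      using gh La by auto
    \<comment> \<open>\<open>g\<close> is the product of \<open>g \<otimes> inv (La g)\<close> in
      \<open>Z\<close> and \<open>La g\<close> in \<open>I\<close>, and \<open>proj\<close> reads
      off the factor in \<open>I\<close>.\<close>
    have "(g \<otimes> inv (La g)) \<otimes> (h \<otimes> inv (La h)) \<in> Z" "La g \<otimes> La h \<in> I"
      using part gh Z I by (auto simp: I_def intro: subgroup.m_closed)
    then have "La ((g \<otimes> inv (La g)) \<otimes> (h \<otimes> inv (La h)) \<otimes> (La g \<otimes> La h)) = La g \<otimes> La h"
      by (rule proj)
    moreover have "(g \<otimes> inv (La g)) \<otimes> (h \<otimes> inv (La h)) \<otimes> (La g \<otimes> La h)
        = (g \<otimes> (inv (La g) \<otimes> La g)) \<otimes> (h \<otimes> (inv (La h) \<otimes> La h))"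
      using gh c by (simp only: m_ac m_closed inv_closed)
    ultimately show ?thesis
      using gh c by simp
  qed
qed

section \<open>The group generated by the colours\<close>

context nonvanishing_colouring
begin

text \<open>Closure under cancellation makes the quotient a group and not just a monoid.\<close>

inductive eqv :: "nat \<Rightarrow> nat \<Rightarrow> bool" where
  colour: "\<lbrakk>coprime s Q; coprime t Q; kap s = kap t\<rbrakk> \<Longrightarrow> eqv s t"
| sym: "eqv s t \<Longrightarrow> eqv t s"
| trans: "\<lbrakk>eqv s t; eqv t u\<rbrakk> \<Longrightarrow> eqv s u"
| mult: "\<lbrakk>eqv s t; coprime u Q\<rbrakk> \<Longrightarrow> eqv (u * s) (u * t)"
| cancel: "eqv (u * s) (u * t) \<Longrightarrow> eqv s t"

lemma eqv_coprime: "eqv s t \<Longrightarrow> coprime s Q \<and> coprime t Q"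
  by (induction rule: eqv.induct) auto

lemma eqv_refl: "coprime s Q \<Longrightarrow> eqv s s"
  by (rule colour) auto

lemma eqv_mult:
  assumes "eqv s s'" "eqv t t'"
  shows "eqv (s * t) (s' * t')"
proof -
  have "eqv (s * t) (s * t')"
    using assms eqv_coprime by (intro eqv.mult) auto
  moreover have "eqv (t' * s) (t' * s')"
    using assms eqv_coprime by (intro eqv.mult) auto
  ultimately show ?thesis
    by (metis eqv.trans mult.commute)
qed

text \<open>Complete multiplicativity settles \<open>mult\<close>; \<open>cancel\<close> divides by
  \<open>f u\<close>, which is nonzero.\<close>

lemma eqv_imp_eq: "eqv s t \<Longrightarrow> f s = f t"
proof (induction rule: eqv.induct)
  case (colour s t)
  then show ?case using colour_determines by blast
next
  case (mult s t u)
  then have "coprime s Q" "coprime t Q"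
    using eqv_coprime by blast+
  then show ?case
    using mult by (simp add: completely_mult)
next
  case (cancel u s t)
  then have "coprime u Q" "coprime s Q" "coprime t Q"
    using eqv_coprime[OF cancel(1)] by auto
  moreover have "f u \<noteq> 0"
    using nonzero pos \<open>coprime u Q\<close> by blast
  ultimately show ?case
    using cancel by (simp add: completely_mult)
qed auto

lemma eqv_gap: "\<lbrakk>i > 1; Q dvd q ^ 2 * m\<rbrakk> \<Longrightarrow> eqv (1 + q ^ i * m) (1 + q ^ 2 * m)"
  by (intro colour gap_one coprime_1_plus_Q)
    (auto intro: dvd_trans[OF _ mult_dvd_mono[OF le_imp_power_dvd dvd_refl]])

text \<open>For \<open>j\<close> beyond the digits of \<open>s\<close> and \<open>t\<close>,
  \<open>s * E t\<close> and \<open>t * E s\<close> are \<open>s\<close> and \<open>t\<close> below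
  one and the same high block, hence of one colour. Cancelling \<open>t\<close> identifies
  \<open>E t\<close> with \<open>E s\<close>, and shortening the gap turns \<open>q ^ j\<close> into
  \<open>q ^ 2\<close>.\<close>

lemma colour_dilate:
  assumes s: "coprime s Q" and t: "coprime t Q" and eq: "kap s = kap t"
  shows "eqv (1 + Q ^ 2 * a * s) (1 + Q ^ 2 * a * t)"
proof -
  obtain c where c: "Q = q * c"
    using Q by blast
  define j where "j = Suc (s + t)"
  have j: "j > 1"
    using pos[OF s] by (simp add: j_def)
  define E where "E x = 1 + q ^ j * (c ^ 2 * a * x)" for x
  have E: "eqv (E x) (1 + Q ^ 2 * a * x)" for x
  proof -
    have eq: "Q ^ 2 * a * x = q ^ 2 * (c ^ 2 * a * x)"
      by (simp add: c power_mult_distrib algebra_simps)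
    have "Q dvd Q ^ 2 * a * x"
      by (simp add: power2_eq_square)
    then show ?thesis
      unfolding E_def eq using j by (intro eqv_gap)
  qed
  have copE: "coprime (E x) Q" for x
    using E eqv_coprime by blast
  have small: "s < q ^ (s + t)" "t < q ^ (s + t)"
    using less_power_q[of "s + t"] by auto
  have "kap (s + q ^ j * (c ^ 2 * a * s * t)) = kap (t + q ^ j * (c ^ 2 * a * s * t))"
    using eq small by (rule low) (simp add: j_def)
  moreover have "s * E t = s + q ^ j * (c ^ 2 * a * s * t)" "t * E s = t + q ^ j * (c ^ 2 * a * s * t)"
    by (simp_all add: E_def algebra_simps)
  moreover have "coprime (s * E t) Q" "coprime (t * E s) Q"
    using s t copE by simp_all
  ultimately have "eqv (s * E t) (t * E s)"
    by (intro colour) simp_all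
  moreover have "eqv (t * E t) (s * E t)"
    using s t eq copE by (intro eqv_mult eqv_refl colour) auto
  ultimately have "eqv (E t) (E s)"
    using eqv.trans eqv.cancel by blast
  then show ?thesis
    using E eqv.sym eqv.trans by blast
qed

text \<open>Induction on the derivation: transitivity multiplies the two multipliers, and cancelling
  \<open>u\<close> multiplies by \<open>u\<close>. The claim for all multiples of the multiplier is
  what lets them combine.\<close>

lemma eqv_dilate:
  "eqv s t \<Longrightarrow> \<exists>u>0. \<forall>a. eqv (1 + Q ^ 2 * (u * a) * s) (1 + Q ^ 2 * (u * a) * t)"
proof (induction rule: eqv.induct)
  case (colour s t)
  then show ?case
    by (intro exI[of _ 1] conjI allI colour_dilate) auto
next
  case (sym s t)
  then show ?case
    using eqv.sym by blast
next
  case (trans s t u)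
  then obtain v w where vw: "v > 0" "w > 0" and
    v: "\<And>a. eqv (1 + Q ^ 2 * (v * a) * s) (1 + Q ^ 2 * (v * a) * t)" and
    w: "\<And>a. eqv (1 + Q ^ 2 * (w * a) * t) (1 + Q ^ 2 * (w * a) * u)"
    by blast
  have "eqv (1 + Q ^ 2 * (v * w * a) * s) (1 + Q ^ 2 * (v * w * a) * u)" for a
    using v[of "w * a"] w[of "v * a"] by (auto simp: ac_simps intro: eqv.trans)
  then show ?case
    using vw by (intro exI[of _ "v * w"]) simp
next
  case (mult s t u)
  then obtain v where v: "v > 0" "\<And>a. eqv (1 + Q ^ 2 * (v * a) * s) (1 + Q ^ 2 * (v * a) * t)"
    by blast
  have "eqv (1 + Q ^ 2 * (v * a) * (u * s)) (1 + Q ^ 2 * (v * a) * (u * t))" for a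
    using v(2)[of "u * a"] by (simp add: ac_simps)
  then show ?case using v(1) by blast
next
  case (cancel u s t)
  then obtain v where v: "v > 0" "\<And>a. eqv (1 + Q ^ 2 * (v * a) * (u * s)) (1 + Q ^ 2 * (v * a) * (u * t))"
    by blast
  have "eqv (1 + Q ^ 2 * (v * u * a) * s) (1 + Q ^ 2 * (v * u * a) * t)" for a
    using v(2)[of a] by (simp add: ac_simps)
  moreover have "u > 0"
    using eqv_coprime[OF cancel(1)] pos by auto
  ultimately show ?case
    using v(1) by (intro exI[of _ "v * u"]) simp
qed

lemma finite_representatives:
  obtains R where "finite R" "\<And>r. r \<in> R \<Longrightarrow> coprime r Q"
    and "\<And>s. coprime s Q \<Longrightarrow> \<exists>r\<in>R. kap r = kap s"
proof -
  let ?N = "{s. coprime s Q}"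
  have "finite (kap ` ?N)"
    using finite_colours by (rule finite_subset[rotated]) auto
  then obtain R where R: "R \<subseteq> ?N" "finite R" "kap ` ?N = kap ` R"
    using finite_subset_image[of "kap ` ?N" kap ?N] by blast
  have "\<exists>r\<in>R. kap r = kap s" if "coprime s Q" for s
  proof -
    have "kap s \<in> kap ` R"
      using that by (simp flip: R(3))
    then show ?thesis by auto
  qed
  then show thesis
    using R by (intro that[of R]) auto
qed

text \<open>The product of the multipliers over all pairs of colour representatives serves every
  pair, since \<open>colour_dilate\<close> passes from \<open>s\<close> and \<open>t\<close> to
  their representatives.\<close>

lemma uniform_dilation:
  obtains M where "M > 0" "Q ^ 2 dvd M"
    and "\<And>s t k. \<lbrakk>eqv s t; M dvd k\<rbrakk> \<Longrightarrow> eqv (1 + k * s) (1 + k * t)"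
proof -
  obtain R where R: "finite R" "\<And>r. r \<in> R \<Longrightarrow> coprime r Q"
    "\<And>s. coprime s Q \<Longrightarrow> \<exists>r\<in>R. kap r = kap s"
    by (rule finite_representatives) (rule that)
  have "\<exists>u>0. eqv r r' \<longrightarrow> (\<forall>a. eqv (1 + Q ^ 2 * (u * a) * r) (1 + Q ^ 2 * (u * a) * r'))" for r r'
    using eqv_dilate[of r r'] by (cases "eqv r r'") auto
  then obtain u where u_pos: "\<And>r r'. u r r' > (0::nat)"
    and u: "\<And>r r' a. eqv r r' \<Longrightarrow> eqv (1 + Q ^ 2 * (u r r' * a) * r) (1 + Q ^ 2 * (u r r' * a) * r')"
    by metis
  define M where "M = Q ^ 2 * (\<Prod>(r, r')\<in>R \<times> R. u r r')"
  have "eqv (1 + k * s) (1 + k * t)" if st: "eqv s t" and k: "M dvd k" for s t k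
  proof -
    have cop: "coprime s Q" "coprime t Q"
      using st eqv_coprime by auto
    obtain r where r: "r \<in> R" "kap r = kap s"
      using R(3) cop by blast
    obtain r' where r': "r' \<in> R" "kap r' = kap t"
      using R(3) cop by blast
    have "Q ^ 2 * u r r' dvd M"
      unfolding M_def using r r' R(1)
      by (intro mult_dvd_mono dvd_refl dvd_prodI[where f = "\<lambda>(r, r'). u r r'" and a = "(r, r')", simplified]) auto
    then obtain a where a: "k = Q ^ 2 * (u r r' * a)"
      using k by (metis dvd_trans dvdE mult.assoc)
    have sr: "eqv s r" and rt: "eqv r' t"
      using r r' R(2) cop by (auto intro: colour)
    have "eqv (1 + k * s) (1 + k * r)"
      unfolding a using r R(2) cop by (intro colour_dilate) auto
    moreover have "eqv (1 + k * r) (1 + k * r')"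
      unfolding a using sr rt st by (intro u) (blast intro: eqv.trans eqv.sym)
    moreover have "eqv (1 + k * r') (1 + k * t)"
      unfolding a using r' R(2) cop by (intro colour_dilate) auto
    ultimately show ?thesis
      by (blast intro: eqv.trans)
  qed
  moreover have "M > 0"
    using u_pos Q by (auto simp: M_def intro!: prod_pos)
  moreover have "Q ^ 2 dvd M"
    by (simp add: M_def)
  ultimately show thesis
    by (intro that[of M])
qed

end

section \<open>The finite abelian group of classes\<close>

locale dilation_colouring = nonvanishing_colouring q kap f Q
  for q and kap :: "nat \<Rightarrow> 'c" and f and Q +
  fixes M :: nat
  assumes M: "M > 0" "Q ^ 2 dvd M"
    and dilate: "\<And>s t k. \<lbrakk>eqv s t; M dvd k\<rbrakk> \<Longrightarrow> eqv (1 + k * s) (1 + k * t)"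
begin

text \<open>Classes are encoded by their least element, so that a class is again a number to which
  \<open>1 + k * x\<close> can be applied.\<close>

definition cl :: "nat \<Rightarrow> nat" where
  "cl s = (LEAST t. eqv s t)"

definition G :: "nat monoid" where
  "G = \<lparr>carrier = cl ` {s. coprime s Q}, mult = (\<lambda>x y. cl (x * y)), one = cl 1\<rparr>"

lemma eqv_cl: "coprime s Q \<Longrightarrow> eqv s (cl s)"
  unfolding cl_def by (rule LeastI) (rule eqv_refl)

lemma cl_eq:
  assumes "eqv s t"
  shows "cl s = cl t"
proof -
  have "eqv s = eqv t"
    using assms eqv.sym eqv.trans by blast
  then show ?thesis
    by (simp add: cl_def)
qed

lemma cl_eq_iff: "\<lbrakk>coprime s Q; coprime t Q\<rbrakk> \<Longrightarrow> cl s = cl t \<longleftrightarrow> eqv s t"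
  using cl_eq eqv_cl[of s] eqv_cl[of t] eqv.sym eqv.trans by metis

lemma carrier_G: "x \<in> carrier G \<longleftrightarrow> (\<exists>s. coprime s Q \<and> x = cl s)"
  by (auto simp: G_def)

lemma cl_in_G: "coprime s Q \<Longrightarrow> cl s \<in> carrier G"
  by (auto simp: carrier_G)

lemma mult_G: "\<lbrakk>coprime s Q; coprime t Q\<rbrakk> \<Longrightarrow> cl s \<otimes>\<^bsub>G\<^esub> cl t = cl (s * t)"
  unfolding G_def by simp (intro cl_eq eqv_mult eqv.sym[OF eqv_cl])

lemma one_G: "\<one>\<^bsub>G\<^esub> = cl 1"
  by (simp add: G_def)

lemma finite_G: "finite (carrier G)"
proof -
  obtain R where R: "finite R" "\<And>r. r \<in> R \<Longrightarrow> coprime r Q"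
    "\<And>s. coprime s Q \<Longrightarrow> \<exists>r\<in>R. kap r = kap s"
    by (rule finite_representatives) (rule that)
  have "carrier G \<subseteq> cl ` R"
  proof
    fix x assume "x \<in> carrier G"
    then obtain s where s: "coprime s Q" "x = cl s"
      using carrier_G by blast
    then obtain r where "r \<in> R" "kap r = kap s"
      using R(3) by blast
    then show "x \<in> cl ` R"
      using R(2) s by (auto intro!: image_eqI[of _ _ r] cl_eq colour)
  qed
  then show ?thesis
    using R(1) finite_surj by blast
qed

text \<open>Inverses come from two equivalent powers of \<open>s\<close> by cancellation.\<close>

lemma comm_group_G: "comm_group G"
proof (rule comm_groupI)
  fix x assume "x \<in> carrier G"
  then obtain s where s: "coprime s Q" "x = cl s"
    using carrier_G by blast
  have "range (\<lambda>n. cl (s ^ n)) \<subseteq> carrier G"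
    using s by (auto intro: cl_in_G)
  then have "\<not> inj (\<lambda>n. cl (s ^ n))"
    using finite_G finite_subset finite_imageD infinite_UNIV_nat by metis
  then obtain i j where ij: "i < j" "cl (s ^ i) = cl (s ^ j)"
    unfolding inj_def by (metis linorder_neqE_nat)
  then obtain d where d: "j = i + Suc d"
    using less_iff_Suc_add by auto
  have "eqv (s ^ i * 1) (s ^ i * (s ^ d * s))"
    using ij s cl_eq_iff[of "s ^ i" "s ^ j"] by (simp add: d power_add ac_simps)
  then have "eqv 1 (s ^ d * s)"
    by (rule eqv.cancel)
  then have "cl (s ^ d) \<otimes>\<^bsub>G\<^esub> x = \<one>\<^bsub>G\<^esub>"
    using s by (simp add: mult_G one_G cl_eq)
  then show "\<exists>y\<in>carrier G. y \<otimes>\<^bsub>G\<^esub> x = \<one>\<^bsub>G\<^esub>"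
    using s by (intro bexI[of _ "cl (s ^ d)"]) (auto intro: cl_in_G)
next
  show "\<one>\<^bsub>G\<^esub> \<in> carrier G"
    by (simp add: one_G cl_in_G)
next
  fix x y assume "x \<in> carrier G" "y \<in> carrier G"
  then show "x \<otimes>\<^bsub>G\<^esub> y \<in> carrier G"
    by (auto simp: carrier_G[of x] carrier_G[of y] mult_G intro!: cl_in_G)
qed (auto simp: carrier_G mult_G one_G ac_simps)


lemma Q_dvd: "M dvd k \<Longrightarrow> Q dvd k"
  using M by (metis dvd_trans dvd_triv_left power2_eq_square)

lemma coprime_1_plus: "M dvd k \<Longrightarrow> coprime (1 + k * x) Q"
  using Q_dvd by (intro coprime_1_plus_Q) auto

lemma cl_dilate: "\<lbrakk>M dvd k; coprime s Q\<rbrakk> \<Longrightarrow> cl (1 + k * cl s) = cl (1 + k * s)"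
  by (intro cl_eq dilate eqv.sym[OF eqv_cl])

text \<open>By Ramsey's theorem the maps \<open>s \<mapsto> 1 + k * s\<close> for three multipliers \<open>k\<close>, \<open>k'\<close>, \<open>k * k'\<close>
  induce the same map on classes, which satisfies the functional equation because
  \<open>(1 + k x) (1 + k k' w x) = 1 + k x (1 + k' w (1 + k x))\<close>.\<close>
lemma projection_multiplier:
  obtains k where "k > 0" "M dvd k"
    and "\<And>x y. \<lbrakk>coprime x Q; coprime y Q\<rbrakk> \<Longrightarrow> cl (1 + k * (x * y)) = cl (1 + k * x) \<otimes>\<^bsub>G\<^esub> cl (1 + k * y)"
    and "\<And>x. coprime x Q \<Longrightarrow> cl (1 + k * (1 + k * x)) = cl (1 + k * x)"
proof -
  interpret G: comm_group G
    by (rule comm_group_G)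
  define La where "La d x = cl (1 + M ^ d * x)" for d x
  define Fn where "Fn d = restrict (La d) (carrier G)" for d
  have M_pow: "M dvd M ^ d" if "d > 0" for d
    using that by (simp add: dvd_power)
  have La_cl: "La d (cl s) = cl (1 + M ^ d * s)" if "d > 0" "coprime s Q" for d s
    unfolding La_def using that by (intro cl_dilate M_pow)
  have La_closed: "La d x \<in> carrier G" if "d > 0" for d x
    unfolding La_def using that by (intro cl_in_G coprime_1_plus M_pow)
  have "Fn ` {0<..} \<subseteq> carrier G \<rightarrow>\<^sub>E carrier G"
    by (auto simp: Fn_def La_closed)
  moreover have "finite (carrier G \<rightarrow>\<^sub>E carrier G)"
    by (intro finite_PiE finite_G)
  ultimately have "finite (Fn ` {0<..})"
    by (rule finite_subset)
  then obtain h and N :: nat where h: "h ` (Fn ` {0<..}) = {i. i < N}" "inj_on h (Fn ` {0<..})"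
    using finite_imp_inj_to_nat_seg by metis
  \<comment> \<open>Pairs of naturals are coloured by the map on classes induced by \<open>M\<close>
    to the power of their difference, numbered by \<open>h\<close>. For \<open>a < b < c\<close> in
    a homogeneous set, the exponents \<open>d\<close>, \<open>d'\<close> and \<open>d + d'\<close>
    induce the same map.\<close>
  have "\<forall>x\<in>UNIV. \<forall>y\<in>UNIV. x \<noteq> y \<longrightarrow> h (Fn (Max {x, y} - Min {x, y})) < N"
  proof (intro ballI impI)
    fix x y :: nat assume "x \<noteq> y"
    then have "Max {x, y} - Min {x, y} > 0"
      by (auto simp: max_def min_def)
    then show "h (Fn (Max {x, y} - Min {x, y})) < N"
      using h(1) by blast
  qed
  then obtain Y t where Y: "infinite Y"
    and t: "\<forall>x\<in>Y. \<forall>y\<in>Y. x \<noteq> y \<longrightarrow> h (Fn (Max {x, y} - Min {x, y})) = t"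
    using Ramsey2[of UNIV "\<lambda>X. h (Fn (Max X - Min X))" N] infinite_UNIV_nat by metis
  obtain a where a: "a \<in> Y"
    using Y by (metis finite.emptyI ex_in_conv)
  obtain b where b: "b \<in> Y" "a < b"
    using Y by (meson infinite_nat_iff_unbounded)
  obtain c where c: "c \<in> Y" "b < c"
    using Y by (meson infinite_nat_iff_unbounded)
  define d d' where "d = b - a" and "d' = c - b"
  have d: "d > 0" "d' > 0" "c - a = d + d'"
    using b c by (auto simp: d_def d'_def)
  have "h (Fn (y - x)) = t" if "x \<in> Y" "y \<in> Y" "x < y" for x y
    using t[rule_format, OF that(1,2)] that(3) by (simp add: max_def min_def)
  then have "h (Fn d) = t" "h (Fn d') = t" "h (Fn (d + d')) = t"
    using a b c d by (auto simp: d_def d'_def simp del: d(3) simp flip: d(3))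
  then have "Fn d' = Fn d" "Fn (d + d') = Fn d"
    using h(2) d by (auto simp: inj_on_def)
  then have same: "La d' x = La d x" "La (d + d') x = La d x" if "x \<in> carrier G" for x
    using that by (metis Fn_def restrict_apply')+
  define k k' where "k = M ^ d" and "k' = M ^ d'"
  have Mk: "M dvd k" "M dvd k'" "M dvd k * k'"
    using d M_pow by (auto simp: k_def k'_def)
  have eq: "La d g \<otimes>\<^bsub>G\<^esub> La d (w \<otimes>\<^bsub>G\<^esub> g) = La d (g \<otimes>\<^bsub>G\<^esub> La d (w \<otimes>\<^bsub>G\<^esub> La d g))"
    if g: "g \<in> carrier G" and w: "w \<in> carrier G" for g w
  proof -
    obtain x where x: "coprime x Q" "g = cl x"
      using g carrier_G by blast
    obtain v where v: "coprime v Q" "w = cl v"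
      using w carrier_G by blast
    define u where "u = 1 + k * x"
    have u: "coprime u Q" "La d g = cl u"
      using coprime_1_plus[OF Mk(1)] x d by (simp_all add: u_def k_def La_cl)
    have "La d (w \<otimes>\<^bsub>G\<^esub> g) = La (d + d') (cl (v * x))"
      using x v by (simp add: mult_G same(2) cl_in_G)
    also have "\<dots> = cl (1 + k * k' * (v * x))"
      using x v d by (simp add: La_cl k_def k'_def power_add)
    finally have "La d g \<otimes>\<^bsub>G\<^esub> La d (w \<otimes>\<^bsub>G\<^esub> g) = cl (u * (1 + k * k' * (v * x)))"
      using u(1) coprime_1_plus[OF Mk(3)] unfolding u(2) by (simp only: mult_G)
    also have "u * (1 + k * k' * (v * x)) = 1 + k * (x * (1 + k' * (v * u)))"
      by (simp add: u_def algebra_simps)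
    also have "cl \<dots> = La d (cl (x * (1 + k' * (v * u))))"
      using x coprime_1_plus[OF Mk(2)] d by (simp only: La_cl k_def coprime_mult_left_iff)
    also have "cl (x * (1 + k' * (v * u))) = g \<otimes>\<^bsub>G\<^esub> cl (1 + k' * (v * u))"
      using x coprime_1_plus[OF Mk(2)] by (simp only: mult_G)
    also have "cl (1 + k' * (v * u)) = La d' (cl (v * u))"
      using v u d by (simp add: La_cl k'_def)
    also have "\<dots> = La d (w \<otimes>\<^bsub>G\<^esub> La d g)"
      using v u by (simp add: same(1) cl_in_G mult_G)
    finally show ?thesis .
  qed
  note proj = G.projection_functional_equation[of "La d", OF finite_G La_closed[OF d(1)] eq]
  show thesis
  proof (rule that[of k])
    show "k > 0" "M dvd k"
      using M Mk by (auto simp: k_def)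
    have La: "La d (cl x) = cl (1 + k * x)" if "coprime x Q" for x
      unfolding k_def using that d by (intro La_cl)
    show "cl (1 + k * (x * y)) = cl (1 + k * x) \<otimes>\<^bsub>G\<^esub> cl (1 + k * y)" if "coprime x Q" "coprime y Q" for x y
      using proj(2)[of "cl x" "cl y"] that by (simp add: cl_in_G mult_G La)
    show "cl (1 + k * (1 + k * x)) = cl (1 + k * x)" if "coprime x Q" for x
      using proj(1)[of "cl x"] that La[OF that] La[OF coprime_1_plus[OF Mk(1), of x]]
      by (simp only: cl_in_G)
  qed
qed

text \<open>Here \<open>y\<close> is a multiple of a representative \<open>r0\<close> of the colour of \<open>r\<close>, so that \<open>r\<close> may be
  replaced by \<open>r0\<close>, which then factors out.\<close>
lemma cl_short_interval:
  assumes k: "M dvd k"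
    and hom: "\<And>x y. \<lbrakk>coprime x Q; coprime y Q\<rbrakk> \<Longrightarrow> cl (1 + k * (x * y)) = cl (1 + k * x) \<otimes>\<^bsub>G\<^esub> cl (1 + k * y)"
    and idem: "\<And>x. coprime x Q \<Longrightarrow> cl (1 + k * (1 + k * x)) = cl (1 + k * x)"
  obtains y where "\<And>i r. \<lbrakk>coprime r Q; r < q ^ i; y < q ^ i\<rbrakk> \<Longrightarrow>
      cl (1 + k * (r + q ^ Suc i * (k * y))) = cl (1 + k * y)"
proof -
  obtain R where R: "finite R" "\<And>r. r \<in> R \<Longrightarrow> coprime r Q"
    "\<And>s. coprime s Q \<Longrightarrow> \<exists>r\<in>R. kap r = kap s"
    by (rule finite_representatives) (rule that)
  define y where "y = \<Prod>R"
  have y: "coprime y Q"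
    unfolding y_def using R(2) by (intro prod_coprime_left)
  have "q ^ 2 dvd k"
    using k M Q by (meson dvd_power_same dvd_trans)
  then obtain k' where k': "k = q ^ 2 * k'" by blast
  have "cl (1 + k * (r + q ^ Suc i * (k * y))) = cl (1 + k * y)"
    if r: "coprime r Q" "r < q ^ i" and yi: "y < q ^ i" for i r
  proof -
    obtain r0 where r0: "r0 \<in> R" "kap r0 = kap r"
      using R(3) r by blast
    have "r0 dvd y"
      unfolding y_def using dvd_prodI[OF R(1) r0(1), of "\<lambda>x. x"] by simp
    then obtain y0 where y0: "y = r0 * y0" by blast
    have cop: "coprime r0 Q" "coprime y0 Q"
      using R(2)[OF r0(1)] y by (auto simp: y0)
    have "r0 \<le> y"
      using \<open>r0 dvd y\<close> pos[OF y] by (rule dvd_imp_le)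
    have "Q dvd q ^ Suc i * (k * y)"
      using Q_dvd[OF k] by auto
    then have c1: "coprime (r + q ^ Suc i * (k * y)) Q"
      using r by (intro coprime_plus_Q)
    have c2: "coprime (1 + k * y0) Q"
      using k by (rule coprime_1_plus)
    have "kap (r + q ^ Suc i * (k * y)) = kap (r0 + q ^ Suc i * (k * y))"
      using r0 r yi \<open>r0 \<le> y\<close> by (intro low[of _ _ i]) auto
    \<comment> \<open>The factor \<open>q ^ 2\<close> of \<open>k\<close> lengthens the gap to
      \<open>i + 3\<close>; shortening it to 2 restores \<open>1 + k * y0\<close>.\<close>
    also have "r0 + q ^ Suc i * (k * y) = r0 * (1 + q ^ (i + 3) * (k' * y0))"
      by (simp add: y0 k' algebra_simps power_add numeral_eq_Suc)
    finally have "kap (r + q ^ Suc i * (k * y)) = kap (r0 * (1 + q ^ (i + 3) * (k' * y0)))" .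
    moreover have e: "eqv (1 + q ^ (i + 3) * (k' * y0)) (1 + k * y0)"
    proof -
      have "Q dvd q ^ 2 * (k' * y0)"
        using Q_dvd[OF k] unfolding k' mult.assoc[symmetric] by auto
      then have "eqv (1 + q ^ (i + 3) * (k' * y0)) (1 + q ^ 2 * (k' * y0))"
        by (intro eqv_gap) auto
      then show ?thesis
        by (simp add: k' mult.assoc)
    qed
    moreover have "coprime (r0 * (1 + q ^ (i + 3) * (k' * y0))) Q"
      unfolding coprime_mult_left_iff using cop(1) eqv_coprime[OF e] by blast
    ultimately have "eqv (r + q ^ Suc i * (k * y)) (r0 * (1 + q ^ (i + 3) * (k' * y0)))"
      using c1 by (intro colour)
    moreover have "eqv (r0 * (1 + q ^ (i + 3) * (k' * y0))) (r0 * (1 + k * y0))"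
      using e cop(1) by (rule eqv.mult)
    ultimately have "eqv (r + q ^ Suc i * (k * y)) (r0 * (1 + k * y0))"
      by (rule eqv.trans)
    then have "cl (1 + k * (r + q ^ Suc i * (k * y))) = cl (1 + k * (r0 * (1 + k * y0)))"
      using k by (intro cl_eq dilate)
    \<comment> \<open>By \<open>idem\<close>, \<open>1 + k * y0\<close> has the same image as
      \<open>y0\<close>, so \<open>hom\<close> reassembles \<open>r0 * y0\<close>.\<close>
    also have "\<dots> = cl (1 + k * r0) \<otimes>\<^bsub>G\<^esub> cl (1 + k * y0)"
      using hom[OF cop(1) c2] idem[OF cop(2)] by simp
    also have "\<dots> = cl (1 + k * y)"
      unfolding y0 using hom[OF cop] by simp
    finally show ?thesis .
  qed
  then show thesis by (rule that)
qed


section \<open>Periodicity\<close>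

text \<open>Local constancy in the archimedean sense: a suitable multiple of \<open>n\<close> and the same multiple
  of \<open>n + Q\<close> lie in one short interval.\<close>
lemma cl_eventually_periodic:
  assumes k: "k > 0" "M dvd k"
    and hom: "\<And>x y. \<lbrakk>coprime x Q; coprime y Q\<rbrakk> \<Longrightarrow> cl (1 + k * (x * y)) = cl (1 + k * x) \<otimes>\<^bsub>G\<^esub> cl (1 + k * y)"
    and idem: "\<And>x. coprime x Q \<Longrightarrow> cl (1 + k * (1 + k * x)) = cl (1 + k * x)"
  obtains B where "\<And>n. \<lbrakk>coprime n Q; n > B\<rbrakk> \<Longrightarrow> cl (1 + k * (n + Q)) = cl (1 + k * n)"
proof -
  interpret G: comm_group G
    by (rule comm_group_G)
  obtain y where y: "\<And>i r. \<lbrakk>coprime r Q; r < q ^ i; y < q ^ i\<rbrakk> \<Longrightarrow>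
      cl (1 + k * (r + q ^ Suc i * (k * y))) = cl (1 + k * y)"
    by (rule cl_short_interval[OF k(2)], erule (1) hom, erule idem, rule that)
  have "cl (1 + k * (n + Q)) = cl (1 + k * n)"
    if n: "coprime n Q" "n > 2 * q * k * y * Q" for n
  proof -
    define i where "i = 2 * (Q + 1) * (n + Q) + y"
    define Y where "Y = q ^ Suc i * (k * y)"
    \<comment> \<open>\<open>t\<close> is 1 modulo \<open>Q\<close>, and \<open>t * n\<close>
      exceeds \<open>Y\<close> by at most \<open>(Q + 1) * n\<close>.\<close>
    define t where "t = Q * (Y div (Q * n) + 1) + 1"
    have i: "y < q ^ i" "2 * (Q + 1) * (n + Q) < q ^ i"
      using less_power_q[of i] by (auto simp: i_def)
    have "n > 0"
      using n(2) by simp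
    have "Y div (Q * n) * (Q * n) \<le> Y" "Y < (Y div (Q * n) + 1) * (Q * n)"
      using \<open>n > 0\<close> Q by (auto simp: dividend_less_div_times)
    then have t: "Y < t * n" "t * n \<le> Y + (Q + 1) * n"
      using \<open>n > 0\<close> by (auto simp: t_def algebra_simps)
    have "Q dvd Y"
      using Q_dvd[OF k(2)] by (simp add: Y_def)
    \<comment> \<open>The shift \<open>t * Q\<close> is about \<open>Y * Q / n\<close>; as
      \<open>n\<close> exceeds \<open>2 * q * k * y * Q\<close>, this is at most half of
      \<open>q ^ i\<close>, up to an error that the choice of \<open>i\<close> absorbs.\<close>
    have "n * (2 * (t * Q)) \<le> 2 * Y * Q + 2 * (Q + 1) * n * Q"
      using mult_right_mono[OF t(2), of "2 * Q"] by (simp add: algebra_simps)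
    also have "2 * Y * Q = q ^ i * (2 * q * k * y * Q)"
      by (simp add: Y_def)
    also have "\<dots> \<le> q ^ i * n"
      using n(2) by (intro mult_left_mono) auto
    finally have "n * (2 * (t * Q)) \<le> n * (q ^ i + 2 * (Q + 1) * Q)"
      by (simp add: algebra_simps)
    then have tQ: "2 * (t * Q) \<le> q ^ i + 2 * (Q + 1) * Q"
      using \<open>n > 0\<close> by simp
    have "2 * (t * n - Y + t * Q) = 2 * (t * n - Y) + 2 * (t * Q)"
      by (rule add_mult_distrib2)
    also have "\<dots> \<le> 2 * ((Q + 1) * n) + (q ^ i + 2 * (Q + 1) * Q)"
      using t(2) tQ by (intro add_mono mult_left_mono) (auto simp: le_diff_conv)
    also have "\<dots> = q ^ i + 2 * (Q + 1) * (n + Q)"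
      by (simp add: algebra_simps)
    also have "\<dots> < 2 * q ^ i"
      using i(2) by linarith
    finally have r: "t * n - Y + t * Q < q ^ i"
      by simp
    have t_cop: "coprime t Q"
      unfolding t_def add.commute[of _ 1] by (intro coprime_1_plus_Q) simp
    have const: "cl (1 + k * (t * m)) = cl (1 + k * y)"
      if m: "coprime m Q" "Y \<le> t * m" "t * m - Y < q ^ i" for m
    proof -
      have "t * m = (t * m - Y) + Y"
        using m(2) by simp
      moreover have "coprime (t * m) Q"
        using t_cop m(1) by simp
      then have "coprime (t * m - Y) Q"
        using \<open>Q dvd Y\<close> m(2)
        by (metis cong_add_lcancel_0_nat cong_0_iff cong_imp_coprime le_add_diff_inverse2)
      ultimately show ?thesis
        using y[OF _ m(3) i(1)] by (metis Y_def)
    qed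
    have nQ: "coprime (n + Q) Q"
      using n(1) by (rule coprime_plus_Q) simp
    have "t * (n + Q) - Y = t * n - Y + t * Q"
      using t(1) by (simp add: add_mult_distrib2)
    then have "cl (1 + k * (t * (n + Q))) = cl (1 + k * y)"
      using nQ t(1) r by (intro const) (auto simp: add_mult_distrib2)
    moreover have "cl (1 + k * (t * n)) = cl (1 + k * y)"
      using n(1) t(1) r by (intro const) auto
    ultimately have "cl (1 + k * (t * (n + Q))) = cl (1 + k * (t * n))"
      by simp
    then have "cl (1 + k * t) \<otimes>\<^bsub>G\<^esub> cl (1 + k * (n + Q)) = cl (1 + k * t) \<otimes>\<^bsub>G\<^esub> cl (1 + k * n)"
      using hom t_cop n(1) nQ by simp
    then show ?thesis
      using coprime_1_plus[OF k(2)] cl_in_G by (simp only: G.Units_l_cancel G.Units_eq)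
  qed
  then show thesis by (rule that)
qed

text \<open>For large \<open>n\<close> that are 1 modulo \<open>Q\<close>, \<open>n * n\<close> and
  \<open>n\<close> have the same image, so the image is an idempotent of the group, hence trivial.
  Thus \<open>1 + k * (1 + Q * m)\<close> is equivalent to 1 for large \<open>m\<close>, and a
  common multiplier takes \<open>s\<close> and \<open>t\<close> to such numbers.\<close>

lemma f_periodic:
  obtains Q' where "Q' > 1" "Q dvd Q'"
    and "\<And>s t. \<lbrakk>coprime s Q'; [s = t] (mod Q')\<rbrakk> \<Longrightarrow> f s = f t"
proof -
  interpret G: comm_group G
    by (rule comm_group_G)
  obtain k where k: "k > 0" "M dvd k"
    and hom: "\<And>x y. \<lbrakk>coprime x Q; coprime y Q\<rbrakk> \<Longrightarrow> cl (1 + k * (x * y)) = cl (1 + k * x) \<otimes>\<^bsub>G\<^esub> cl (1 + k * y)"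
    and idem: "\<And>x. coprime x Q \<Longrightarrow> cl (1 + k * (1 + k * x)) = cl (1 + k * x)"
    by (rule projection_multiplier) (rule that)
  obtain B where B: "\<And>n. \<lbrakk>coprime n Q; n > B\<rbrakk> \<Longrightarrow> cl (1 + k * (n + Q)) = cl (1 + k * n)"
    by (rule cl_eventually_periodic[OF k], erule (1) hom, erule idem, rule that)
  have periodic: "cl (1 + k * (n + Q * m)) = cl (1 + k * n)" if n: "coprime n Q" "n > B" for n m
  proof (induction m)
    case (Suc m)
    have "coprime (n + Q * m) Q"
      using n by (intro coprime_plus_Q) auto
    then have "cl (1 + k * (n + Q * m + Q)) = cl (1 + k * (n + Q * m))"
      using n by (intro B) auto
    then show ?case
      using Suc by (simp add: algebra_simps)
  qed simp
  have trivial: "eqv (1 + k * (1 + Q * m)) 1" if m: "m > B" for m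
  proof -
    define n where "n = 1 + Q * m"
    have n: "coprime n Q"
      unfolding n_def by (intro coprime_1_plus_Q) simp
    have "1 * m \<le> Q * m"
      using Q by (intro mult_right_mono) auto
    then have "n > B"
      unfolding n_def mult_1 using m by linarith
    have "cl (1 + k * n) \<otimes>\<^bsub>G\<^esub> cl (1 + k * n) = cl (1 + k * (n * n))"
      using hom n by simp
    also have "n * n = n + Q * (m * n)"
      by (simp add: n_def algebra_simps)
    also have "cl (1 + k * (n + Q * (m * n))) = cl (1 + k * n)"
      using n \<open>n > B\<close> by (rule periodic)
    finally have "cl (1 + k * n) = \<one>\<^bsub>G\<^esub>"
      using coprime_1_plus[OF k(2)] cl_in_G by (simp only: G.l_cancel_one)
    then show ?thesis
      using coprime_1_plus[OF k(2), of n] cl_eq_iff[of "1 + k * n" 1] by (simp add: one_G n_def)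
  qed
  define Q' where "Q' = k * Q"
  have "f s = f t" if s: "coprime s Q'" and st: "[s = t] (mod Q')" for s t
  proof -
    have t: "coprime t Q'"
      using cong_imp_coprime[OF st] s by (simp add: coprime_commute)
    obtain x where x: "[s * x = 1] (mod Q')"
      using cong_solve_coprime_nat[OF s] by auto
    \<comment> \<open>\<open>w\<close> is \<open>(1 + k) / s\<close> modulo \<open>Q'\<close>; the
      added multiple of \<open>Q'\<close> makes \<open>w * u\<close> so large that
      \<open>w * u = 1 + k * (1 + Q * m)\<close> with \<open>m > B\<close>.\<close>
    define w where "w = x * (1 + k) + Q' * (B + 1 + (1 + k))"
    have inverse: "eqv (w * u) 1" if u: "u > 0" "[u * x = 1] (mod Q')" for u
    proof -
      have "w * u = u * x * (1 + k) + Q' * ((B + 1 + (1 + k)) * u)"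
        by (simp add: w_def algebra_simps)
      also have "[\<dots> = u * x * (1 + k)] (mod Q')"
        by (simp add: cong_def)
      also have "[u * x * (1 + k) = 1 * (1 + k)] (mod Q')"
        using u by (intro cong_mult cong_refl)
      finally have c: "[w * u = 1 + k] (mod Q')"
        by simp
      have "Q' > 0"
        using k Q by (simp add: Q'_def)
      then have "1 * (1 + k) \<le> Q' * (1 + k)"
        by (intro mult_right_mono) auto
      then have "Q' * (B + 1) + (1 + k) \<le> Q' * (B + 1 + (1 + k))"
        unfolding add_mult_distrib2[of Q' "B + 1" "1 + k"] mult_1 by (rule add_left_mono)
      also have "\<dots> \<le> w * 1"
        by (simp add: w_def)
      also have "\<dots> \<le> w * u"
        using u by (intro mult_left_mono) auto
      finally have large: "Q' * (B + 1) + (1 + k) \<le> w * u" .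
      then obtain m where m: "w * u = 1 + k + Q' * m"
        using c by (metis add_leD2 cong_le_nat mult.commute add.commute)
      then have "Q' * (B + 1) \<le> Q' * m"
        using large by linarith
      then have "m > B"
        using \<open>Q' > 0\<close> unfolding mult_le_cancel1 by simp
      moreover have "w * u = 1 + k * (1 + Q * m)"
        unfolding m by (simp add: Q'_def algebra_simps)
      ultimately show ?thesis
        using trivial by simp
    qed
    have "Q dvd Q'"
      by (simp add: Q'_def)
    then have pos': "u > 0" if "coprime u Q'" for u
      using that pos by (meson coprime_divisors dvd_refl)
    have "[t * x = 1] (mod Q')"
      using x st by (meson cong_scalar_right cong_sym cong_trans)
    then have "eqv (w * s) (w * t)"
      using inverse x s t pos' eqv.sym eqv.trans by meson
    then show ?thesis
      by (rule eqv_imp_eq[OF eqv.cancel])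
  qed
  moreover have "Q' > 1"
    using k Q by (simp add: Q'_def less_1_mult' Suc_lessI)
  ultimately show thesis
    by (intro that[of Q']) (auto simp: Q'_def)
qed

end

section \<open>The Dirichlet character\<close>

theorem theorem1:
  fixes q :: nat and f :: "nat \<Rightarrow> complex"
  assumes "q \<ge> 2"
    and "multiplicative f"
    and "q_automatic q f"
  shows "\<exists>\<chi> (Q::nat) m. dirichlet_character m \<chi> \<and> Q \<ge> 1 \<and>
           ((\<forall>n. n > 0 \<longrightarrow> coprime n Q \<longrightarrow> f n = \<chi> n) \<or>
            (\<exists>N. \<forall>p. prime p \<longrightarrow> p \<ge> N \<longrightarrow> f p = 0))"
proof (cases "finite {p. prime p \<and> f p \<noteq> 0}")
  case True
  then obtain N where "\<forall>p\<in>{p. prime p \<and> f p \<noteq> 0}. p < N"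
    using finite_nat_set_iff_bounded by blast
  then have "\<forall>p. prime p \<longrightarrow> p \<ge> N \<longrightarrow> f p = 0"
    by (auto simp: not_less[symmetric])
  \<comment> \<open>A default character, since the second alternative does not involve it.\<close>
  moreover have "dirichlet_character 1 (\<lambda>_. 1)"
    by (simp add: dirichlet_character_def)
  ultimately show ?thesis
    by (intro exI[of _ "\<lambda>_. 1"] exI[of _ 1] conjI disjI2 exI[of _ N]) auto
next
  case False
  obtain b and kap :: "nat \<Rightarrow> (nat \<Rightarrow> complex) \<Rightarrow> nat \<Rightarrow> complex" where "digit_colouring b kap f"
    using automatic_imp_digit_colouring[OF assms(1,3)] by blast
  then interpret multiplicative_colouring b kap f
    using assms(2) False by (simp add: multiplicative_colouring_def multiplicative_colouring_axioms_def)
  obtain Q where Q: "Q > 1" "b dvd Q" "(b - 1) dvd Q" "\<And>n. \<lbrakk>n > 0; coprime n Q\<rbrakk> \<Longrightarrow> f n \<noteq> 0"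
    by (rule nonzero_on_coprimes) (rule that)
  interpret nonvanishing_colouring b kap f Q
    by unfold_locales (use Q in auto)
  obtain M where M: "M > 0" "Q ^ 2 dvd M"
    "\<And>s t k. \<lbrakk>eqv s t; M dvd k\<rbrakk> \<Longrightarrow> eqv (1 + k * s) (1 + k * t)"
    by (rule uniform_dilation) (rule that)
  interpret dilation_colouring b kap f Q M
    by unfold_locales (use M in auto)
  obtain Q' where Q': "Q' > 1" "Q dvd Q'"
    and per: "\<And>s t. \<lbrakk>coprime s Q'; [s = t] (mod Q')\<rbrakk> \<Longrightarrow> f s = f t"
    by (rule f_periodic) (rule that)
  \<comment> \<open>Extension of the periodic values by zero; as \<open>Q' > 1\<close>, the
    unconstrained value \<open>f 0\<close> is excluded.\<close>
  define \<chi> where "\<chi> n = (if coprime n Q' then f n else 0)" for n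
  have cop: "coprime n Q" if "coprime n Q'" for n
    using that Q'(2) by (meson coprime_divisors dvd_refl)
  have "dirichlet_character Q' \<chi>"
    unfolding dirichlet_character_def
  proof (intro conjI allI)
    show "Q' \<ge> 1" using Q' by simp
    show "\<chi> (x * y) = \<chi> x * \<chi> y" for x y
      using completely_mult cop by (simp add: \<chi>_def)
    show "\<chi> (n + Q') = \<chi> n" for n
    proof -
      have "coprime (n + Q') Q' \<longleftrightarrow> coprime n Q'"
        unfolding coprime_iff_gcd_eq_1 by (simp only: gcd_add1)
      then show ?thesis
        using per[of n "n + Q'"] by (auto simp: \<chi>_def cong_def)
    qed
    show "\<chi> 1 = 1"
      using f_1 by (simp add: \<chi>_def)
    show "\<chi> n = 0 \<longleftrightarrow> \<not> coprime n Q'" for n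
      using nonzero[OF pos[OF cop] cop] by (auto simp: \<chi>_def)
  qed
  moreover have "\<forall>n. n > 0 \<longrightarrow> coprime n Q' \<longrightarrow> f n = \<chi> n"
    by (simp add: \<chi>_def)
  ultimately show ?thesis
    using Q'(1) by (intro exI[of _ \<chi>] exI[of _ Q']) auto
qed

end
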